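(* Let $f\in L_\infty(\Omega_n,\nu)$ with $\int f\,d\nu=0$ and let $j\in[n]$. Then $$R_j^\varepsilon(\Phi(f))=-\frac{\sqrt2\,\mu_j^{-1}}{\mu_j^2+\mu_j^{-2}}\,\gamma_j^*\,\Phi(R_jf),\qquad R_{-j}^\varepsilon(\Phi(f))=\frac{\sqrt2\,\mu_j}{\mu_j^2+\mu_j^{-2}}\,\gamma_j\,\Phi(R_jf).$$
   Context: Biased hypercube: for $n\ge1$, $[n]=\{1,\dots,n\}$ and $\mu_1,\dots,\mu_n>0$, $\Omega_n=\{-1,1\}^n$ carries $\nu=\nu_1\times\cdots\times\nu_n$, $\nu_j(\{-1\})=\frac{\mu_j^2}{\mu_j^{-2}+\mu_j^2}$, $\nu_j(\{1\})=\frac{\mu_j^{-2}}{\mu_j^{-2}+\mu_j^2}$. $\zeta_j(\omega)=\mu_j^2$ if $\omega_j=1$, $-\mu_j^{-2}$ if $\omega_j=-1$; $\zeta_\varnothing=1$, $\zeta_A=\prod_{j\in A}\zeta_j$; $\{\zeta_A\}_{A\subseteq[n]}$ is an orthonormal basis of $L_2(\Omega_n,\nu)$. $D_j(\zeta_A)=\zeta_{A\setminus\{j\}}$ if $j\in A$, $0$ otherwise; $N=\sum_jD_j^*D_j$, so $N\zeta_A=|A|\zeta_A$; on mean-zero functions $N^{-1/2}\zeta_A=|A|^{-1/2}\zeta_A$ ($A\ne\varnothing$) and $R_j=\frac{\mu_j^{-2}+\mu_j^2}{2}D_jN^{-1/2}$. Baby Fock model: $[\pm n]=\{\pm1,\dots,\pm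 n\}$; $\varepsilon:[\pm n]\times[\pm n]\to\{-1,1\}$ satisfies $\varepsilon(i,j)=\varepsilon(j,i)=\varepsilon(|i|,|j|)$, $\varepsilon(i,i)=-1$. Let $x_j$ ($j\in[\pm n]$) be self-adjoint matrices in $M_{2^{2n}}(\mathbb C)$ with $x_ix_j-\varepsilon(i,j)x_jx_i=2\delta_{i,j}I$, and for $S=\{s_1<\dots<s_k\}\subseteq[\pm n]$ put $x_S=x_{s_1}\cdots x_{s_k}$, $x_\emptyset={\bf1}$; these are chosen so that $\{x_S\}$ is linearly independent and so a basis of the generated algebra. $H$ is the span of the $x_S$ with inner product $\langle x,y\rangle=\varphi_{n,\varepsilon}(x^*y)$, $\varphi_{n,\varepsilon}(x_S)=\delta_{S,\emptyset}$; $\{x_S\}$ is an orthonormal basis. For $j\in[\pm n]$, $\beta_j(x_S)=x_jx_S$ if $j\in S$, $0$ otherwise; $\beta_j^*(x_S)=x_jx_S$ if $j\notin S$, $0$ otherwise. $\gamma_j=\mu_j\beta_{-j}+\mu_j^{-1}\beta_j^*$ ($j\in[n]$); $\Gamma_{n,\varepsilon}\subseteq B(H)$ is the von Neumann algebra they generate, with vacuum state $\tau_{n,\varepsilon}(X)=\langle{\bf1},X{\bf1}\rangle$ and bijective GNS map $\phi_{n,\varepsilon}:\Gamma_{n,\varepsilon}\to H$, $\phi_{n,\varepsilon}(X)=X{\bf1}$. $N^\varepsilon=\sum_{i\in[\pm n]}\beta_i^*\beta_i$ (so $N^\varepsilon x_S=|S|x_S$), and for $j\in[\pm n]$, $R_j^\varepsilon=\phi_{n,\varepsilon}^{-1}\circ\beta_j(N^\varepsilon)^{-1/2}\circ\phi_{n,\varepsilon}$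 on $\Gamma_{n,\varepsilon}^0=\{X:\tau_{n,\varepsilon}(X)=0\}$. Embedding: $\eta_j=\gamma_j^*\gamma_j-\mu_j^{-2}{\rm Id}$ ($j\in[n]$); these commute with one another; $\eta_\emptyset={\rm Id}$, $\eta_A=\prod_{j\in A}\eta_j$. $\Phi:L_\infty(\Omega_n,\nu)\to\Gamma_{n,\varepsilon}$ is the state-preserving injective unital $*$-homomorphism determined linearly by $\Phi(\zeta_A)=\eta_A$, $A\subseteq[n]$. *)

theory Defs
  imports
    "HOL-Analysis.Analysis"
    "HOL-Library.FuncSet"
    "HOL-Library.Function_Algebras"
begin

section \<open>Operators on subspaces\<close>

text \<open>
  Both \<open>L\<^sub>2(\<Omega>\<^sub>n, \<nu>)\<close> and \<open>H\<close> depend on \<open>n\<close>, so each is a set \<open>V\<close> inside a type carrying a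
  complex scaling \<open>s\<close>. Operators on \<open>V\<close> are extensional functions (\<open>undefined\<close> off \<open>V\<close>), so that
  equality of operators on \<open>V\<close> is HOL equality. The inner product \<open>ip\<close> is conjugate linear in its
  first argument. All the spaces are finite dimensional, hence every operator is bounded.
\<close>

definition lin_ops :: "(complex \<Rightarrow> 'v::ab_group_add \<Rightarrow> 'v) \<Rightarrow> 'v set \<Rightarrow> ('v \<Rightarrow> 'v) set" where
  "lin_ops s V = {T \<in> V \<rightarrow>\<^sub>E V.
     (\<forall>v\<in>V. \<forall>w\<in>V. T (v + w) = T v + T w) \<and> (\<forall>c. \<forall>v\<in>V. T (s c v) = s c (T v))}"

definition adj ::
    "(complex \<Rightarrow> 'v::ab_group_add \<Rightarrow> 'v) \<Rightarrow> 'v set \<Rightarrow> ('v \<Rightarrow> 'v \<Rightarrow> complex) \<Rightarrow> ('v \<Rightarrow> 'v) \<Rightarrow> 'v \<Rightarrow> 'v" where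
  "adj s V ip T = (THE S. S \<in> lin_ops s V \<and> (\<forall>v\<in>V. \<forall>w\<in>V. ip (T v) w = ip v (S w)))"

text \<open>
  \<open>T\<^sup>-\<^sup>1\<^sup>/\<^sup>2\<close> on a subspace \<open>V\<close> on which \<open>T\<close> is strictly positive: the positive operator on \<open>V\<close> whose
  square inverts \<open>T\<close> there.
\<close>

definition inv_sqrt ::
    "(complex \<Rightarrow> 'v::ab_group_add \<Rightarrow> 'v) \<Rightarrow> 'v set \<Rightarrow> ('v \<Rightarrow> 'v \<Rightarrow> complex) \<Rightarrow> ('v \<Rightarrow> 'v) \<Rightarrow> 'v \<Rightarrow> 'v" where
  "inv_sqrt s V ip T = (THE Q. Q \<in> lin_ops s V \<and>
     (\<forall>v\<in>V. ip v (Q v) \<in> \<real>\<^sub>\<ge>\<^sub>0) \<and> (\<forall>v\<in>V. Q (Q (T v)) = v))"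

text \<open>
  The linear map with \<open>b i \<mapsto> g i\<close> for \<open>i \<in> I\<close>, where \<open>b\<close> is a linearly independent family over the
  finite set \<open>I\<close>; to be applied on the span of this family only.
\<close>

definition lin_ext ::
    "(complex \<Rightarrow> 'v::ab_group_add \<Rightarrow> 'v) \<Rightarrow> (complex \<Rightarrow> 'w::ab_group_add \<Rightarrow> 'w) \<Rightarrow>
     'i set \<Rightarrow> ('i \<Rightarrow> 'v) \<Rightarrow> ('i \<Rightarrow> 'w) \<Rightarrow> 'v \<Rightarrow> 'w" where
  "lin_ext s s' I b g v = (\<Sum>i\<in>I. s' (module.representation s (b ` I) v (b i)) (g i))"

text \<open>The commutant inside \<open>B(V)\<close>, von Neumann algebras on \<open>V\<close>, and the one generated by \<open>G\<close>.\<close>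

definition commutant ::
    "(complex \<Rightarrow> 'v::ab_group_add \<Rightarrow> 'v) \<Rightarrow> 'v set \<Rightarrow> ('v \<Rightarrow> 'v) set \<Rightarrow> ('v \<Rightarrow> 'v) set" where
  "commutant s V M = {T \<in> lin_ops s V. \<forall>X\<in>M. compose V T X = compose V X T}"

definition von_neumann_algebra ::
    "(complex \<Rightarrow> 'v::ab_group_add \<Rightarrow> 'v) \<Rightarrow> 'v set \<Rightarrow> ('v \<Rightarrow> 'v \<Rightarrow> complex) \<Rightarrow> ('v \<Rightarrow> 'v) set \<Rightarrow> bool" where
  "von_neumann_algebra s V ip M \<longleftrightarrow> M \<subseteq> lin_ops s V \<and> (\<forall>X\<in>M. adj s V ip X \<in> M) \<and>
     commutant s V (commutant s V M) = M"

definition vN_generated ::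
    "(complex \<Rightarrow> 'v::ab_group_add \<Rightarrow> 'v) \<Rightarrow> 'v set \<Rightarrow> ('v \<Rightarrow> 'v \<Rightarrow> complex) \<Rightarrow> ('v \<Rightarrow> 'v) set \<Rightarrow> ('v \<Rightarrow> 'v) set" where
  "vN_generated s V ip G = \<Inter>{M. von_neumann_algebra s V ip M \<and> G \<subseteq> M}"


section \<open>The biased hypercube\<close>

definition fn_scale :: "complex \<Rightarrow> ('a \<Rightarrow> complex) \<Rightarrow> 'a \<Rightarrow> complex" where
  "fn_scale c f = (\<lambda>\<omega>. c * f \<omega>)"

global_interpretation fn: vector_space "fn_scale :: complex \<Rightarrow> ('a \<Rightarrow> complex) \<Rightarrow> _"
  by standard (auto simp: fn_scale_def fun_eq_iff algebra_simps)

definition Omega :: "nat \<Rightarrow> (nat \<Rightarrow> int) set" where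
  "Omega n = {1..n} \<rightarrow>\<^sub>E {-1, 1}"

definition nu1 :: "real \<Rightarrow> int measure" where
  "nu1 m = point_measure {-1, 1}
     (\<lambda>s. ennreal ((if s = 1 then m powi (-2) else m powi 2) / (m powi (-2) + m powi 2)))"

definition nu :: "nat \<Rightarrow> (nat \<Rightarrow> real) \<Rightarrow> (nat \<Rightarrow> int) measure" where
  "nu n \<mu> = Pi\<^sub>M {1..n} (\<lambda>j. nu1 (\<mu> j))"

text \<open>
  Every point of \<open>\<Omega>\<^sub>n\<close> has positive mass, so \<open>L\<^sub>\<infinity>(\<Omega>\<^sub>n, \<nu>) = L\<^sub>2(\<Omega>\<^sub>n, \<nu>)\<close> consists of all complex
  functions on \<open>\<Omega>\<^sub>n\<close>; they are extended by \<open>0\<close> to the whole type.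
\<close>

definition L_Omega :: "nat \<Rightarrow> ((nat \<Rightarrow> int) \<Rightarrow> complex) set" where
  "L_Omega n = {f. \<forall>\<omega>. \<omega> \<notin> Omega n \<longrightarrow> f \<omega> = 0}"

definition L_Omega0 :: "nat \<Rightarrow> (nat \<Rightarrow> real) \<Rightarrow> ((nat \<Rightarrow> int) \<Rightarrow> complex) set" where
  "L_Omega0 n \<mu> = {f \<in> L_Omega n. (LINT \<omega>|nu n \<mu>. f \<omega>) = 0}"

definition L_ip ::
    "nat \<Rightarrow> (nat \<Rightarrow> real) \<Rightarrow> ((nat \<Rightarrow> int) \<Rightarrow> complex) \<Rightarrow> ((nat \<Rightarrow> int) \<Rightarrow> complex) \<Rightarrow> complex" where
  "L_ip n \<mu> f g = (LINT \<omega>|nu n \<mu>. cnj (f \<omega>) * g \<omega>)"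

definition zeta :: "nat \<Rightarrow> (nat \<Rightarrow> real) \<Rightarrow> nat set \<Rightarrow> (nat \<Rightarrow> int) \<Rightarrow> complex" where
  "zeta n \<mu> A = (\<lambda>\<omega>. if \<omega> \<in> Omega n
     then (\<Prod>j\<in>A. complex_of_real (if \<omega> j = 1 then \<mu> j powi 2 else - (\<mu> j powi (-2)))) else 0)"

definition D_op ::
    "nat \<Rightarrow> (nat \<Rightarrow> real) \<Rightarrow> nat \<Rightarrow> ((nat \<Rightarrow> int) \<Rightarrow> complex) \<Rightarrow> ((nat \<Rightarrow> int) \<Rightarrow> complex)" where
  "D_op n \<mu> j = (\<lambda>f \<in> L_Omega n. lin_ext fn_scale fn_scale (Pow {1..n}) (zeta n \<mu>)
     (\<lambda>A. if j \<in> A then zeta n \<mu> (A - {j}) else 0) f)"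

definition N_op ::
    "nat \<Rightarrow> (nat \<Rightarrow> real) \<Rightarrow> ((nat \<Rightarrow> int) \<Rightarrow> complex) \<Rightarrow> ((nat \<Rightarrow> int) \<Rightarrow> complex)" where
  "N_op n \<mu> = (\<lambda>f \<in> L_Omega n.
     \<Sum>j\<in>{1..n}. adj fn_scale (L_Omega n) (L_ip n \<mu>) (D_op n \<mu> j) (D_op n \<mu> j f))"

definition R_op ::
    "nat \<Rightarrow> (nat \<Rightarrow> real) \<Rightarrow> nat \<Rightarrow> ((nat \<Rightarrow> int) \<Rightarrow> complex) \<Rightarrow> ((nat \<Rightarrow> int) \<Rightarrow> complex)" where
  "R_op n \<mu> j = (\<lambda>f \<in> L_Omega0 n \<mu>.
     fn_scale (complex_of_real ((\<mu> j powi (-2) + \<mu> j powi 2) / 2))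
       (D_op n \<mu> j (inv_sqrt fn_scale (L_Omega0 n \<mu>) (L_ip n \<mu>) (N_op n \<mu>) f)))"


section \<open>The baby Fock model\<close>

definition mat_scale :: "complex \<Rightarrow> complex^'m^'m \<Rightarrow> complex^'m^'m" where
  "mat_scale c A = map_matrix ((*) c) A"

global_interpretation mat: vector_space "mat_scale :: complex \<Rightarrow> complex^'m^'m \<Rightarrow> _"
  by standard (auto simp: mat_scale_def vec_eq_iff algebra_simps)

definition mat_adj :: "complex^'m^'m \<Rightarrow> complex^'m^'m" where
  "mat_adj A = transpose (map_matrix cnj A)"

definition pm :: "nat \<Rightarrow> int set" where
  "pm n = {- int n..int n} - {0}"

definition x_prod :: "(int \<Rightarrow> complex^'m^'m) \<Rightarrow> int set \<Rightarrow> complex^'m^'m" where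
  "x_prod x S = foldr (**) (map x (sorted_list_of_set S)) (mat 1)"

definition H :: "nat \<Rightarrow> (int \<Rightarrow> complex^'m^'m) \<Rightarrow> (complex^'m^'m) set" where
  "H n x = mat.span (x_prod x ` Pow (pm n))"

definition H_state :: "nat \<Rightarrow> (int \<Rightarrow> complex^'m^'m) \<Rightarrow> complex^'m^'m \<Rightarrow> complex" where
  "H_state n x = lin_ext mat_scale (*) (Pow (pm n)) (x_prod x) (\<lambda>S. if S = {} then 1 else 0)"

definition H_ip :: "nat \<Rightarrow> (int \<Rightarrow> complex^'m^'m) \<Rightarrow> complex^'m^'m \<Rightarrow> complex^'m^'m \<Rightarrow> complex" where
  "H_ip n x a b = H_state n x (mat_adj a ** b)"

text \<open>
  \<open>\<beta>\<^sub>j\<^sup>*\<close> is introduced by its values on the basis; it is the adjoint of \<open>\<beta>\<^sub>j\<close> for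
  \<open>H_ip\<close> because \<open>x\<^sub>j\<close> is self-adjoint with \<open>x\<^sub>j\<^sup>2 = 1\<close>.
\<close>

definition beta :: "nat \<Rightarrow> (int \<Rightarrow> complex^'m^'m) \<Rightarrow> int \<Rightarrow> complex^'m^'m \<Rightarrow> complex^'m^'m" where
  "beta n x j = (\<lambda>h \<in> H n x. lin_ext mat_scale mat_scale (Pow (pm n)) (x_prod x)
     (\<lambda>S. if j \<in> S then x j ** x_prod x S else 0) h)"

definition beta_star :: "nat \<Rightarrow> (int \<Rightarrow> complex^'m^'m) \<Rightarrow> int \<Rightarrow> complex^'m^'m \<Rightarrow> complex^'m^'m" where
  "beta_star n x j = (\<lambda>h \<in> H n x. lin_ext mat_scale mat_scale (Pow (pm n)) (x_prod x)
     (\<lambda>S. if j \<notin> S then x j ** x_prod x S else 0) h)"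

definition N_eps :: "nat \<Rightarrow> (int \<Rightarrow> complex^'m^'m) \<Rightarrow> complex^'m^'m \<Rightarrow> complex^'m^'m" where
  "N_eps n x = (\<lambda>h \<in> H n x. \<Sum>i\<in>pm n. beta_star n x i (beta n x i h))"

definition gamma ::
    "nat \<Rightarrow> (nat \<Rightarrow> real) \<Rightarrow> (int \<Rightarrow> complex^'m^'m) \<Rightarrow> nat \<Rightarrow> complex^'m^'m \<Rightarrow> complex^'m^'m" where
  "gamma n \<mu> x j = (\<lambda>h \<in> H n x.
     mat_scale (complex_of_real (\<mu> j)) (beta n x (- int j) h) +
     mat_scale (complex_of_real (inverse (\<mu> j))) (beta_star n x (int j) h))"

abbreviation H_adj ::
    "nat \<Rightarrow> (int \<Rightarrow> complex^'m^'m) \<Rightarrow> (complex^'m^'m \<Rightarrow> complex^'m^'m) \<Rightarrow> complex^'m^'m \<Rightarrow> complex^'m^'m" where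
  "H_adj n x \<equiv> adj mat_scale (H n x) (H_ip n x)"

definition Gamma ::
    "nat \<Rightarrow> (nat \<Rightarrow> real) \<Rightarrow> (int \<Rightarrow> complex^'m^'m) \<Rightarrow> (complex^'m^'m \<Rightarrow> complex^'m^'m) set" where
  "Gamma n \<mu> x = vN_generated mat_scale (H n x) (H_ip n x) (gamma n \<mu> x ` {1..n})"

definition tau :: "nat \<Rightarrow> (int \<Rightarrow> complex^'m^'m) \<Rightarrow> (complex^'m^'m \<Rightarrow> complex^'m^'m) \<Rightarrow> complex" where
  "tau n x X = H_ip n x (mat 1) (X (mat 1))"

definition Gamma0 ::
    "nat \<Rightarrow> (nat \<Rightarrow> real) \<Rightarrow> (int \<Rightarrow> complex^'m^'m) \<Rightarrow> (complex^'m^'m \<Rightarrow> complex^'m^'m) set" where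
  "Gamma0 n \<mu> x = {X \<in> Gamma n \<mu> x. tau n x X = 0}"

definition gns :: "(complex^'m^'m \<Rightarrow> complex^'m^'m) \<Rightarrow> complex^'m^'m" where
  "gns X = X (mat 1)"

text \<open>
  \<open>(N\<^sup>\<epsilon>)\<^sup>-\<^sup>1\<^sup>/\<^sup>2\<close> lives on the orthogonal complement of the vacuum, which is the image of \<open>\<Gamma>\<^sup>0\<close> under
  the GNS map.
\<close>

definition H0 :: "nat \<Rightarrow> (int \<Rightarrow> complex^'m^'m) \<Rightarrow> (complex^'m^'m) set" where
  "H0 n x = {h \<in> H n x. H_ip n x (mat 1) h = 0}"

definition R_eps ::
    "nat \<Rightarrow> (nat \<Rightarrow> real) \<Rightarrow> (int \<Rightarrow> complex^'m^'m) \<Rightarrow> int \<Rightarrow>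
     (complex^'m^'m \<Rightarrow> complex^'m^'m) \<Rightarrow> complex^'m^'m \<Rightarrow> complex^'m^'m" where
  "R_eps n \<mu> x j = (\<lambda>X \<in> Gamma0 n \<mu> x. the_inv_into (Gamma n \<mu> x) gns
     (beta n x j (inv_sqrt mat_scale (H0 n x) (H_ip n x) (N_eps n x) (gns X))))"


section \<open>The embedding\<close>

definition eta ::
    "nat \<Rightarrow> (nat \<Rightarrow> real) \<Rightarrow> (int \<Rightarrow> complex^'m^'m) \<Rightarrow> nat \<Rightarrow> complex^'m^'m \<Rightarrow> complex^'m^'m" where
  "eta n \<mu> x j = (\<lambda>h \<in> H n x.
     H_adj n x (gamma n \<mu> x j) (gamma n \<mu> x j h) - mat_scale (complex_of_real (\<mu> j powi (-2))) h)"

text \<open>The \<open>\<eta>\<^sub>j\<close> commute, so multiplying them in increasing order of \<open>j\<close> is no restriction.\<close>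

definition eta_prod ::
    "nat \<Rightarrow> (nat \<Rightarrow> real) \<Rightarrow> (int \<Rightarrow> complex^'m^'m) \<Rightarrow> nat set \<Rightarrow> complex^'m^'m \<Rightarrow> complex^'m^'m" where
  "eta_prod n \<mu> x A =
     foldr (compose (H n x)) (map (eta n \<mu> x) (sorted_list_of_set A)) (\<lambda>h \<in> H n x. h)"

definition Phi ::
    "nat \<Rightarrow> (nat \<Rightarrow> real) \<Rightarrow> (int \<Rightarrow> complex^'m^'m) \<Rightarrow>
     ((nat \<Rightarrow> int) \<Rightarrow> complex) \<Rightarrow> complex^'m^'m \<Rightarrow> complex^'m^'m" where
  "Phi n \<mu> x f = (\<lambda>h \<in> H n x. lin_ext fn_scale mat_scale (Pow {1..n}) (zeta n \<mu>)
     (\<lambda>A. eta_prod n \<mu> x A h) f)"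

definition op_scale ::
    "nat \<Rightarrow> (int \<Rightarrow> complex^'m^'m) \<Rightarrow> complex \<Rightarrow> (complex^'m^'m \<Rightarrow> complex^'m^'m) \<Rightarrow>
     complex^'m^'m \<Rightarrow> complex^'m^'m" where
  "op_scale n x c T = (\<lambda>h \<in> H n x. mat_scale c (T h))"

end

theory Submission
  imports Defs
begin

text \<open>
  Write \<open>1\<close> for the vacuum and \<open>w\<^sub>A = \<eta>\<^sub>A 1\<close>. An operator \<open>X \<in> \<Gamma>\<close> is determined by \<open>X 1\<close>
  (\<open>vacuum_separating\<close>): mirror images of the \<open>\<gamma>\<^sub>j\<close>, built from multiplication on the right, and their adjoints
  commute with \<open>\<Gamma>\<close>, and applied to \<open>1\<close> they produce all of \<open>H\<close>. Hence
  \<open>R\<^sup>\<epsilon>(\<Phi>(f))\<close> is the only element of \<open>\<Gamma>\<close> whose value at \<open>1\<close> is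
  \<open>\<beta> (N\<^sup>\<epsilon>)\<^sup>-\<^sup>1\<^sup>/\<^sup>2 \<Phi>(f) 1\<close>. The right-hand sides of the claim belong to \<open>\<Gamma>\<close>, so both
  identities may be checked at \<open>1\<close>, where by linearity \<open>f = \<zeta>\<^sub>A\<close> with \<open>A \<noteq> {}\<close>.

  There the computation is short. The vector \<open>w\<^sub>A\<close> is the product of the commuting pairs
  \<open>x\<^bsub>-a\<^esub> x\<^sub>a\<close> over \<open>a \<in> A\<close> (\<open>pair_vec_remove\<close>). Each element of \<open>A\<close> occupies two indices, so
  \<open>N\<^sup>\<epsilon> w\<^sub>A = 2|A| w\<^sub>A\<close>, whereas \<open>N \<zeta>\<^sub>A = |A| \<zeta>\<^sub>A\<close>; this is where \<open>\<surd>2\<close> comes from.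
  For \<open>j \<in> A\<close> and \<open>B = A - {j}\<close>, since \<open>x\<^sub>j\<close> and \<open>x\<^bsub>-j\<^esub>\<close> anticommute and square to one,
  \<open>\<beta>\<^sub>j w\<^sub>A = x\<^sub>j x\<^bsub>-j\<^esub> x\<^sub>j w\<^sub>B = - x\<^bsub>-j\<^esub> w\<^sub>B\<close> and \<open>\<beta>\<^bsub>-j\<^esub> w\<^sub>A = x\<^sub>j w\<^sub>B\<close>.
  On a vector such as \<open>w\<^sub>B\<close>, in which neither \<open>j\<close> nor \<open>-j\<close> is occupied, \<open>\<gamma>\<^sub>j\<close> is multiplication by
  \<open>\<mu>\<^sub>j\<^sup>-\<^sup>1 x\<^sub>j\<close> and its adjoint is multiplication by \<open>\<mu>\<^sub>j x\<^bsub>-j\<^esub>\<close> (\<open>gamma_unoccupied\<close>), so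
  \<open>\<beta>\<^sub>j w\<^sub>A\<close> and \<open>\<beta>\<^bsub>-j\<^esub> w\<^sub>A\<close> are multiples of \<open>\<gamma>\<^sub>j\<^sup>* w\<^sub>B\<close> and \<open>\<gamma>\<^sub>j w\<^sub>B\<close> (\<open>beta_pair_vec\<close>).
  As \<open>R\<^sub>j \<zeta>\<^sub>A\<close> is a multiple of \<open>\<zeta>\<^sub>B\<close> and \<open>\<Phi>(\<zeta>\<^sub>B) 1 = w\<^sub>B\<close>, comparing the scalars finishes the
  proof (\<open>R_eps_Phi\<close>).
\<close>

section \<open>Linear maps out of a finite-dimensional subspace\<close>

text \<open>
  In contrast to \<open>lin_ops\<close>, the target space is free and values off \<open>V\<close> are not constrained, so that
  functionals, maps between the two models and plain restrictions of total functions are covered.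
\<close>

definition linear_on ::
    "(complex \<Rightarrow> 'v::ab_group_add \<Rightarrow> 'v) \<Rightarrow> (complex \<Rightarrow> 'w::ab_group_add \<Rightarrow> 'w) \<Rightarrow> 'v set \<Rightarrow> ('v \<Rightarrow> 'w) \<Rightarrow> bool" where
  "linear_on s s' V F \<longleftrightarrow>
     (\<forall>v\<in>V. \<forall>w\<in>V. F (v + w) = F v + F w) \<and> (\<forall>c. \<forall>v\<in>V. F (s c v) = s' c (F v))"

lemma linear_onD:
  assumes "linear_on s s' V F"
  shows linear_on_add: "v \<in> V \<Longrightarrow> w \<in> V \<Longrightarrow> F (v + w) = F v + F w"
    and linear_on_scale: "v \<in> V \<Longrightarrow> F (s c v) = s' c (F v)"
  using assms by (auto simp: linear_on_def)

lemma linear_on_subset: "linear_on s s' V F \<Longrightarrow> U \<subseteq> V \<Longrightarrow> linear_on s s' U F"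
  unfolding linear_on_def by blast

lemma lin_ops_iff: "T \<in> lin_ops s V \<longleftrightarrow> T \<in> V \<rightarrow>\<^sub>E V \<and> linear_on s s V T"
  by (auto simp: lin_ops_def linear_on_def)

lemma lin_opsD:
  assumes "T \<in> lin_ops s V"
  shows lin_ops_in: "v \<in> V \<Longrightarrow> T v \<in> V"
    and lin_ops_linear: "linear_on s s V T"
    and lin_ops_undefined: "v \<notin> V \<Longrightarrow> T v = undefined"
  using assms by (auto simp: lin_ops_iff)

lemma lin_ops_eqI:
  assumes "S \<in> lin_ops s V" "T \<in> lin_ops s V" "\<And>v. v \<in> V \<Longrightarrow> S v = T v"
  shows "S = T"
  using assms by (metis ext lin_ops_undefined)

lemma linear_on_sum:
  assumes "vector_space s" "vector_space s'" "module.subspace s V" "linear_on s s' V F"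
    and "finite J" "\<And>i. i \<in> J \<Longrightarrow> b i \<in> V"
  shows "F (\<Sum>i\<in>J. s (a i) (b i)) = (\<Sum>i\<in>J. s' (a i) (F (b i)))"
proof -
  interpret V1: vector_space s by fact
  interpret V2: vector_space s' by fact
  have zero: "F 0 = 0"
    using linear_on_add[OF assms(4), of 0 0] V1.subspace_0[OF assms(3)] by simp
  show ?thesis using assms(5,6)
  proof (induction J rule: finite_induct)
    case empty
    then show ?case using zero by simp
  next
    case (insert i J)
    have "s (a i) (b i) \<in> V" "(\<Sum>i\<in>J. s (a i) (b i)) \<in> V"
      using insert.prems assms(3) by (auto intro!: V1.subspace_sum V1.subspace_scale)
    then show ?case
      using insert by (simp add: linear_on_add[OF assms(4)] linear_on_scale[OF assms(4)])
  qed
qed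

lemma (in vector_space) span_image_expand:
  assumes "finite I" "inj_on b I" "v \<in> span (b ` I)"
  obtains a where "v = (\<Sum>i\<in>I. scale (a i) (b i))"
proof -
  obtain u where "v = (\<Sum>w\<in>b ` I. scale (u w) w)"
    using assms span_finite[of "b ` I"] by auto
  then have "v = (\<Sum>i\<in>I. scale (u (b i)) (b i))"
    by (simp add: sum.reindex[OF assms(2)])
  then show ?thesis by (rule that)
qed

lemma lin_ext_basis:
  assumes "vector_space s" "vector_space s'" "finite I" "inj_on b I"
    and "\<not> module.dependent s (b ` I)" "i \<in> I"
  shows "lin_ext s s' I b g (b i) = g i"
proof -
  interpret V1: vector_space s by fact
  interpret V2: vector_space s' by fact
  have "lin_ext s s' I b g (b i) = (\<Sum>k\<in>I. s' (if k = i then 1 else 0) (g k))"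
    unfolding lin_ext_def
    by (intro sum.cong refl arg_cong2[where f = s'])
       (use assms in \<open>auto simp: V1.representation_basis inj_on_eq_iff\<close>)
  also have "\<dots> = (\<Sum>k\<in>I. if k = i then g k else 0)"
    by (intro sum.cong) auto
  finally show ?thesis using assms by simp
qed

lemma linear_on_lin_ext:
  assumes "vector_space s" "vector_space s'" "\<not> module.dependent s (b ` I)"
    and "V \<subseteq> module.span s (b ` I)"
  shows "linear_on s s' V (lin_ext s s' I b g)"
proof -
  interpret V1: vector_space s by fact
  interpret V2: vector_space s' by fact
  show ?thesis
    using assms(3,4)
    by (auto simp: linear_on_def lin_ext_def V1.representation_add V1.representation_scale subset_iff
        V2.scale_left_distrib sum.distrib V2.scale_sum_right V2.scale_scale)
qed


section \<open>Finite orthonormal bases\<close>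

text \<open>
  The hypercube space, the Fock space and the complements of their constants are all treated as a
  subspace \<open>V\<close> with a finite orthonormal basis. The one assumption on the form \<open>ip\<close> is that it is the
  standard one in the coordinates of \<open>e\<close>; sesquilinearity, positivity and the linear independence of \<open>e\<close>
  are consequences.
\<close>

locale onb_space = vector_space s
  for s :: "complex \<Rightarrow> 'v::ab_group_add \<Rightarrow> 'v" +
  fixes V :: "'v set" and ip :: "'v \<Rightarrow> 'v \<Rightarrow> complex" and I :: "'i set" and e :: "'i \<Rightarrow> 'v"
  assumes finite_I: "finite I"
    and V_eq: "V = span (e ` I)"
    and ip_coords: "ip (\<Sum>i\<in>I. s (a i) (e i)) (\<Sum>i\<in>I. s (b i) (e i)) = (\<Sum>i\<in>I. cnj (a i) * b i)"
begin

lemma basis_in [simp]: "i \<in> I \<Longrightarrow> e i \<in> V"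
  by (auto simp: V_eq span_base)

lemma subspace_V: "subspace V"
  by (simp add: V_eq)

lemma V_add [simp]: "v \<in> V \<Longrightarrow> w \<in> V \<Longrightarrow> v + w \<in> V"
  and V_diff [simp]: "v \<in> V \<Longrightarrow> w \<in> V \<Longrightarrow> v - w \<in> V"
  and V_scale [simp]: "v \<in> V \<Longrightarrow> s c v \<in> V"
  and V_zero [simp]: "0 \<in> V"
  and V_sum: "(\<And>k. k \<in> K \<Longrightarrow> g k \<in> V) \<Longrightarrow> sum g K \<in> V"
  using subspace_V by (auto intro: subspace_add subspace_diff subspace_scale subspace_0 subspace_sum)

lemma unit_coords: "i \<in> I \<Longrightarrow> e i = (\<Sum>k\<in>I. s (if k = i then 1 else 0) (e k))"
proof -
  assume "i \<in> I"
  have "(\<Sum>k\<in>I. s (if k = i then 1 else 0) (e k)) = (\<Sum>k\<in>I. if k = i then e k else 0)"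
    by (intro sum.cong) auto
  then show ?thesis using \<open>i \<in> I\<close> finite_I by simp
qed

lemma ip_basis_coords:
  assumes "i \<in> I"
  shows "ip (e i) (\<Sum>k\<in>I. s (b k) (e k)) = b i"
proof -
  have "ip (e i) (\<Sum>k\<in>I. s (b k) (e k)) =
      ip (\<Sum>k\<in>I. s (if k = i then 1 else 0) (e k)) (\<Sum>k\<in>I. s (b k) (e k))"
    using unit_coords[OF assms] by simp
  also have "\<dots> = (\<Sum>k\<in>I. if k = i then b k else 0)"
    unfolding ip_coords by (intro sum.cong) auto
  finally show ?thesis using assms finite_I by simp
qed

lemma ip_basis: "i \<in> I \<Longrightarrow> k \<in> I \<Longrightarrow> ip (e i) (e k) = (if i = k then 1 else 0)"
  using ip_basis_coords[of i "\<lambda>l. if l = k then 1 else 0"] unit_coords[of k] by simp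

lemma inj_on_basis: "inj_on e I"
  by (rule inj_onI) (metis ip_basis zero_neq_one)

lemma expand: "v \<in> V \<Longrightarrow> v = (\<Sum>i\<in>I. s (ip (e i) v) (e i))"
proof -
  assume "v \<in> V"
  then obtain a where a: "v = (\<Sum>i\<in>I. s (a i) (e i))"
    using span_image_expand[OF finite_I inj_on_basis] V_eq by metis
  then have "ip (e i) v = a i" if "i \<in> I" for i
    using ip_basis_coords[OF that] by simp
  then show ?thesis using a by (metis (mono_tags, lifting) sum.cong)
qed

lemma independent_basis: "independent (e ` I)"
proof (rule independent_if_scalars_zero)
  show "finite (e ` I)" using finite_I by simp
  fix f x assume sum: "(\<Sum>x\<in>e ` I. s (f x) x) = 0" and "x \<in> e ` I"
  then obtain i where i: "i \<in> I" "x = e i" by auto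
  have "ip (e i) (\<Sum>k\<in>I. s (f (e k)) (e k)) = f (e i)"
    using ip_basis_coords[of i "\<lambda>k. f (e k)"] i by simp
  moreover have "(\<Sum>k\<in>I. s (f (e k)) (e k)) = (\<Sum>k\<in>I. s 0 (e k))"
    using sum by (simp add: sum.reindex[OF inj_on_basis])
  ultimately show "f x = 0"
    using ip_basis_coords[of i "\<lambda>_. 0"] i by metis
qed

lemma parseval: "v \<in> V \<Longrightarrow> w \<in> V \<Longrightarrow> ip v w = (\<Sum>i\<in>I. cnj (ip (e i) v) * ip (e i) w)"
  using ip_coords[of "\<lambda>i. ip (e i) v" "\<lambda>i. ip (e i) w"]
  by (simp flip: expand)

lemma linear_on_ip_basis: "i \<in> I \<Longrightarrow> linear_on s (*) V (ip (e i))"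
  unfolding linear_on_def
proof (intro conjI ballI allI)
  assume i: "i \<in> I"
  fix v w assume "v \<in> V" "w \<in> V"
  then have "v + w = (\<Sum>i\<in>I. s (ip (e i) v + ip (e i) w) (e i))"
    using expand[of v] expand[of w] by (simp add: scale_left_distrib sum.distrib)
  then show "ip (e i) (v + w) = ip (e i) v + ip (e i) w"
    using ip_basis_coords[OF i] by metis
next
  assume i: "i \<in> I"
  fix c v assume "v \<in> V"
  then have "s c v = (\<Sum>i\<in>I. s (c * ip (e i) v) (e i))"
    by (subst expand[OF \<open>v \<in> V\<close>]) (simp add: scale_sum_right)
  then show "ip (e i) (s c v) = c * ip (e i) v"
    using ip_basis_coords[OF i] by metis
qed

lemma linear_on_ip:
  assumes "v \<in> V"
  shows "linear_on s (*) V (ip v)"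
  unfolding linear_on_def
proof (intro conjI ballI allI)
  fix w w' assume "w \<in> V" "w' \<in> V"
  then show "ip v (w + w') = ip v w + ip v w'"
    using assms by (simp add: parseval[of v] linear_on_add[OF linear_on_ip_basis] distrib_left sum.distrib)
next
  fix c w assume "w \<in> V"
  then show "ip v (s c w) = c * ip v w"
    using assms by (simp add: parseval[of v] linear_on_scale[OF linear_on_ip_basis] sum_distrib_left mult.left_commute)
qed

lemma ip_cnj: "v \<in> V \<Longrightarrow> w \<in> V \<Longrightarrow> ip v w = cnj (ip w v)"
  by (simp add: parseval[of v w] parseval[of w v] mult.commute)

lemma ip_add_right: "v \<in> V \<Longrightarrow> w \<in> V \<Longrightarrow> w' \<in> V \<Longrightarrow> ip v (w + w') = ip v w + ip v w'"
  and ip_scale_right: "v \<in> V \<Longrightarrow> w \<in> V \<Longrightarrow> ip v (s c w) = c * ip v w"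
  using linear_on_ip by (auto simp: linear_on_def)

lemma ip_add_left: "v \<in> V \<Longrightarrow> w \<in> V \<Longrightarrow> w' \<in> V \<Longrightarrow> ip (w + w') v = ip w v + ip w' v"
  and ip_scale_left: "v \<in> V \<Longrightarrow> w \<in> V \<Longrightarrow> ip (s c w) v = cnj c * ip w v"
  by (simp_all add: ip_cnj[of _ v] ip_add_right ip_scale_right)

lemma ip_diff_right: "v \<in> V \<Longrightarrow> w \<in> V \<Longrightarrow> w' \<in> V \<Longrightarrow> ip v (w - w') = ip v w - ip v w'"
  using ip_add_right[of v "w - w'" w'] by simp

lemma ip_sum_left:
  assumes "v \<in> V" "finite J" "\<And>i. i \<in> J \<Longrightarrow> b i \<in> V"
  shows "ip (\<Sum>i\<in>J. s (a i) (b i)) v = (\<Sum>i\<in>J. cnj (a i) * ip (b i) v)"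
proof -
  have "ip v (\<Sum>i\<in>J. s (a i) (b i)) = (\<Sum>i\<in>J. a i * ip v (b i))"
    using assms by (intro linear_on_sum[OF vector_space_axioms vector_space_over_itself.vector_space_axioms
        subspace_V linear_on_ip]) auto
  then show ?thesis
    using assms by (simp add: ip_cnj[of _ v] V_sum)
qed

lemma ip_self: "v \<in> V \<Longrightarrow> ip v v = complex_of_real (\<Sum>i\<in>I. (cmod (ip (e i) v))\<^sup>2)"
  unfolding parseval[of v v] of_real_sum
  by (intro sum.cong refl) (metis complex_norm_square mult.commute)

lemma ip_self_eq_0: "v \<in> V \<Longrightarrow> ip v v = 0 \<Longrightarrow> v = 0"
proof -
  assume v: "v \<in> V" and "ip v v = 0"
  then have "\<forall>i\<in>I. ip (e i) v = 0"
    using finite_I by (simp add: ip_self sum_nonneg_eq_0_iff del: of_real_sum)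
  then show "v = 0"
    using expand[OF v] by simp
qed

lemma ip_nondegenerate:
  assumes "v \<in> V" "w \<in> V" "\<And>u. u \<in> V \<Longrightarrow> ip u v = ip u w"
  shows "v = w"
  using ip_self_eq_0[of "v - w"] assms by (simp add: ip_diff_right)

lemma linear_on_expand:
  assumes "vector_space s'" "linear_on s s' V F" "v \<in> V"
  shows "F v = (\<Sum>i\<in>I. s' (ip (e i) v) (F (e i)))"
  using linear_on_sum[OF vector_space_axioms assms(1) subspace_V assms(2) finite_I, of e "\<lambda>i. ip (e i) v"]
    arg_cong[OF expand[OF assms(3)], of F] by simp

lemma linear_on_eqI:
  assumes "vector_space s'" "linear_on s s' V F" "linear_on s s' V G"
    and "\<And>i. i \<in> I \<Longrightarrow> F (e i) = G (e i)" "v \<in> V"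
  shows "F v = G v"
  using linear_on_expand[OF assms(1,2,5)] linear_on_expand[OF assms(1,3,5)] assms(4) by simp

text \<open>
  Coordinates with respect to an orthonormal basis are inner products, which replaces the abstract
  coefficients in \<open>lin_ext\<close> by computable ones.
\<close>

lemma lin_ext_eq:
  assumes "vector_space s'" "v \<in> V"
  shows "lin_ext s s' I e g v = (\<Sum>i\<in>I. s' (ip (e i) v) (g i))"
proof -
  have "lin_ext s s' I e g v = (\<Sum>i\<in>I. s' (ip (e i) v) (lin_ext s s' I e g (e i)))"
    by (rule linear_on_expand[OF assms(1) _ assms(2)])
       (rule linear_on_lin_ext[OF vector_space_axioms assms(1) independent_basis], simp add: V_eq)
  also have "\<dots> = (\<Sum>i\<in>I. s' (ip (e i) v) (g i))"
    by (intro sum.cong refl arg_cong2[where f = s']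
        lin_ext_basis[OF vector_space_axioms assms(1) finite_I inj_on_basis independent_basis])
  finally show ?thesis .
qed

lemma linear_on_diagonal: "linear_on s s V (\<lambda>v. \<Sum>i\<in>I. s (c i * ip (e i) v) (e i))"
  by (auto simp: linear_on_def linear_on_add[OF linear_on_ip_basis] linear_on_scale[OF linear_on_ip_basis]
      distrib_left scale_left_distrib sum.distrib scale_sum_right mult.left_commute intro!: sum.cong)

subsection \<open>Adjoints\<close>

text \<open>
  Nondegeneracy of the form makes the adjoint unique, so any candidate that satisfies its defining
  relation is the value of the description in \<open>adj\<close>.
\<close>

lemma adj_eqI:
  assumes "\<And>v. v \<in> V \<Longrightarrow> T v \<in> V" "S \<in> lin_ops s V"
    and "\<And>v w. v \<in> V \<Longrightarrow> w \<in> V \<Longrightarrow> ip (T v) w = ip v (S w)"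
  shows "adj s V ip T = S"
  unfolding adj_def
proof (rule the_equality)
  show "S \<in> lin_ops s V \<and> (\<forall>v\<in>V. \<forall>w\<in>V. ip (T v) w = ip v (S w))"
    using assms by auto
next
  fix S' assume S': "S' \<in> lin_ops s V \<and> (\<forall>v\<in>V. \<forall>w\<in>V. ip (T v) w = ip v (S' w))"
  show "S' = S"
  proof (rule lin_ops_eqI)
    fix w assume w: "w \<in> V"
    show "S' w = S w"
      by (rule ip_nondegenerate) (use w S' assms lin_ops_in in \<open>metis\<close>)+
  qed (use S' assms in auto)
qed

text \<open>
  An adjoint exists because its coordinates can be prescribed: the coordinate of \<open>T\<^sup>* w\<close> along
  \<open>e\<^sub>i\<close> has to be the inner product of \<open>T e\<^sub>i\<close> with \<open>w\<close>.
\<close>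

lemma adj_in_lin_ops_and_ip:
  assumes "T \<in> lin_ops s V"
  shows "adj s V ip T \<in> lin_ops s V \<and> (\<forall>v\<in>V. \<forall>w\<in>V. ip (T v) w = ip v (adj s V ip T w))"
proof -
  define S where "S = (\<lambda>w\<in>V. \<Sum>i\<in>I. s (ip (T (e i)) w) (e i))"
  have Te: "T (e i) \<in> V" if "i \<in> I" for i
    using that by (simp add: lin_ops_in[OF assms])
  have "S \<in> lin_ops s V"
    using Te by (auto simp: S_def lin_ops_def V_sum ip_add_right ip_scale_right
        scale_left_distrib sum.distrib scale_sum_right)
  moreover have rel: "ip (T v) w = ip v (S w)" if "v \<in> V" "w \<in> V" for v w
  proof -
    have "T v = (\<Sum>i\<in>I. s (ip (e i) v) (T (e i)))"
      using linear_on_expand[OF vector_space_axioms lin_ops_linear[OF assms] that(1)] .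
    then have "ip (T v) w = (\<Sum>i\<in>I. cnj (ip (e i) v) * ip (T (e i)) w)"
      using ip_sum_left[OF that(2) finite_I, of "\<lambda>i. T (e i)"] Te by simp
    also have "\<dots> = ip v (S w)"
      using that lin_ops_in[OF \<open>S \<in> lin_ops s V\<close> that(2)]
      by (simp add: parseval[of v "S w"]) (simp add: S_def ip_basis_coords)
    finally show ?thesis .
  qed
  ultimately show ?thesis
    using adj_eqI[of T S] lin_ops_in[OF assms] by auto
qed

lemmas adj_in_lin_ops = adj_in_lin_ops_and_ip[THEN conjunct1]

lemma ip_adj: "T \<in> lin_ops s V \<Longrightarrow> v \<in> V \<Longrightarrow> w \<in> V \<Longrightarrow> ip v (adj s V ip T w) = ip (T v) w"
  and ip_adj_left: "T \<in> lin_ops s V \<Longrightarrow> v \<in> V \<Longrightarrow> w \<in> V \<Longrightarrow> ip (adj s V ip T v) w = ip v (T w)"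
proof -
  show *: "T \<in> lin_ops s V \<Longrightarrow> v \<in> V \<Longrightarrow> w \<in> V \<Longrightarrow> ip v (adj s V ip T w) = ip (T v) w" for v w
    using adj_in_lin_ops_and_ip by auto
  show "T \<in> lin_ops s V \<Longrightarrow> v \<in> V \<Longrightarrow> w \<in> V \<Longrightarrow> ip (adj s V ip T v) w = ip v (T w)"
    using *[of w v] ip_cnj[of "adj s V ip T v" w] ip_cnj[of v "T w"]
    by (simp add: lin_ops_in[OF adj_in_lin_ops] lin_ops_in)
qed

lemma adj_eq_on_basisI:
  assumes "T \<in> lin_ops s V" "S \<in> lin_ops s V"
    and "\<And>i k. i \<in> I \<Longrightarrow> k \<in> I \<Longrightarrow> ip (T (e i)) (e k) = ip (e i) (S (e k))"
  shows "adj s V ip T = S"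
proof (rule lin_ops_eqI)
  fix v assume v: "v \<in> V"
  have "adj s V ip T (e k) = S (e k)" if k: "k \<in> I" for k
  proof -
    have in_V: "adj s V ip T (e k) \<in> V" "S (e k) \<in> V"
      using k by (auto intro!: lin_ops_in[OF adj_in_lin_ops] lin_ops_in[OF assms(2)] assms(1))
    have "(\<Sum>i\<in>I. s (ip (e i) (adj s V ip T (e k))) (e i)) = (\<Sum>i\<in>I. s (ip (e i) (S (e k))) (e i))"
      using k by (simp add: ip_adj[OF assms(1)] assms(3))
    then show ?thesis
      using in_V by (simp flip: expand)
  qed
  then show "adj s V ip T v = S v"
    using linear_on_eqI[OF vector_space_axioms lin_ops_linear[OF adj_in_lin_ops[OF assms(1)]]
        lin_ops_linear[OF assms(2)] _ v] by blast
qed (use assms adj_in_lin_ops in auto)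

subsection \<open>The inverse square root of a positive operator\<close>

text \<open>
  With \<open>c = t\<^sup>-\<^sup>1\<^sup>/\<^sup>2\<close> and \<open>w = Q v - c v\<close>, the relation \<open>Q\<^sup>2 v = c\<^sup>2 v\<close> gives
  \<open>Q w = - c w\<close>. Positivity of \<open>Q\<close> at \<open>w\<close> then forces \<open>-c |w|\<^sup>2 \<ge> 0\<close>, that is \<open>w = 0\<close>.
\<close>

lemma inv_sqrt_unique_aux:
  assumes Q: "Q \<in> lin_ops s V" and pos: "\<And>v. v \<in> V \<Longrightarrow> ip v (Q v) \<in> \<real>\<^sub>\<ge>\<^sub>0"
    and inv: "\<And>v. v \<in> V \<Longrightarrow> Q (Q (T v)) = v"
    and v: "v \<in> V" "T v = s (complex_of_real t) v" "t > 0"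
  shows "Q v = s (complex_of_real (1 / sqrt t)) v"
proof -
  define c where "c = complex_of_real (1 / sqrt t)"
  define w where "w = Q v - s c v"
  have c2: "c * c * complex_of_real t = 1"
    using v(3) by (simp add: c_def divide_simps flip: of_real_mult)
  have Qv: "Q v \<in> V" using lin_ops_in[OF Q v(1)] .
  have wV: "w \<in> V" using Qv v by (simp add: w_def)
  have sQ: "Q (s a u) = s a (Q u)" if "u \<in> V" for a u
    using linear_on_scale[OF lin_ops_linear[OF Q] that] .
  have "s (complex_of_real t) (Q (Q v)) = v"
    using inv[OF v(1)] v sQ Qv by simp
  then have "s (c * c) (s (complex_of_real t) (Q (Q v))) = s (c * c) v" by simp
  then have QQ: "Q (Q v) = s (c * c) v" by (simp add: c2 scale_one)
  have "Q v = w + s c v" by (simp add: w_def)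
  then have "Q (Q v) = Q w + s c (Q v)"
    using linear_on_add[OF lin_ops_linear[OF Q], of w "s c v"] wV v sQ by simp
  then have "Q w = s (- c) w"
    using QQ by (simp add: w_def scale_right_diff_distrib)
  then have neg: "- c * ip w w \<in> \<real>\<^sub>\<ge>\<^sub>0"
    using pos[OF wV] ip_scale_right[OF wV wV, of "- c"] by metis
  define r where "r = (\<Sum>i\<in>I. (cmod (ip (e i) w))\<^sup>2)"
  have r: "ip w w = complex_of_real r" "r \<ge> 0"
    using ip_self[OF wV] by (auto simp: r_def sum_nonneg)
  have "- c * ip w w = complex_of_real (- (1 / sqrt t) * r)"
    by (simp add: c_def r)
  then have "- (1 / sqrt t) * r \<ge> 0"
    using neg by (simp only: nonneg_Reals_of_real_iff)
  then have "ip w w = 0"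
    using r v(3) by (simp add: divide_le_0_iff)
  then have "w = 0" by (rule ip_self_eq_0[OF wV])
  then show ?thesis by (simp add: w_def c_def)
qed

text \<open>
  The diagonal operator with entries \<open>l\<^sub>i\<^sup>-\<^sup>1\<^sup>/\<^sup>2\<close> is one inverse square root, and the eigenvector
  argument shows that it is the only one. The second part is stated for arbitrary eigenvectors because
  it is applied to signed multiples of basis vectors.
\<close>

lemma inv_sqrt_props:
  assumes T: "linear_on s s V T"
    and diag: "\<And>i. i \<in> I \<Longrightarrow> T (e i) = s (complex_of_real (l i)) (e i)" "\<And>i. i \<in> I \<Longrightarrow> l i > 0"
  shows "inv_sqrt s V ip T \<in> lin_ops s V"
    and "v \<in> V \<Longrightarrow> T v = s (complex_of_real t) v \<Longrightarrow> t > 0 \<Longrightarrow>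
           inv_sqrt s V ip T v = s (complex_of_real (1 / sqrt t)) v"
proof -
  let ?P = "\<lambda>Q. Q \<in> lin_ops s V \<and> (\<forall>v\<in>V. ip v (Q v) \<in> \<real>\<^sub>\<ge>\<^sub>0) \<and> (\<forall>v\<in>V. Q (Q (T v)) = v)"
  define c where "c i = complex_of_real (1 / sqrt (l i))" for i
  define Q where "Q = (\<lambda>v\<in>V. \<Sum>i\<in>I. s (c i * ip (e i) v) (e i))"
  have Qlin: "Q \<in> lin_ops s V"
    using linear_on_diagonal[of c] by (auto simp: Q_def lin_ops_iff V_sum linear_on_def)
  have c2: "c i * c i * complex_of_real (l i) = 1" if "i \<in> I" for i
    using diag(2)[OF that] by (simp add: c_def divide_simps flip: of_real_mult)
  have ipQ: "ip (e i) (Q v) = c i * ip (e i) v" if "i \<in> I" "v \<in> V" for i v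
    using that by (simp add: Q_def ip_basis_coords)
  have Tv: "T v = (\<Sum>i\<in>I. s (complex_of_real (l i) * ip (e i) v) (e i))" if "v \<in> V" for v
    using linear_on_expand[OF vector_space_axioms T that] diag(1)
    by (simp add: mult.commute)
  have TV: "T v \<in> V" if "v \<in> V" for v
    using Tv[OF that] V_sum[of I "\<lambda>i. s (complex_of_real (l i) * ip (e i) v) (e i)"] by simp
  have PQ: "?P Q"
  proof (intro conjI ballI)
    fix v assume v: "v \<in> V"
    then have QvV: "Q v \<in> V" using lin_ops_in[OF Qlin] by simp
    have "ip v (Q v) = (\<Sum>i\<in>I. complex_of_real ((cmod (ip (e i) v))\<^sup>2 * (1 / sqrt (l i))))"
      unfolding parseval[OF v QvV]
      by (intro sum.cong refl) (simp add: ipQ v c_def complex_norm_square mult_ac del: of_real_power)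
    also have "\<dots> \<in> \<real>\<^sub>\<ge>\<^sub>0"
      unfolding of_real_sum[symmetric] nonneg_Reals_of_real_iff
      by (intro sum_nonneg mult_nonneg_nonneg) (auto dest: diag(2))
    finally show "ip v (Q v) \<in> \<real>\<^sub>\<ge>\<^sub>0" .
    have "Q (Q (T v)) = (\<Sum>i\<in>I. s (ip (e i) (Q (Q (T v)))) (e i))"
      by (rule expand) (intro lin_ops_in[OF Qlin] TV v)
    also have "\<dots> = (\<Sum>i\<in>I. s (ip (e i) v) (e i))"
    proof (intro sum.cong refl arg_cong2[where f = s])
      fix i assume i: "i \<in> I"
      have "ip (e i) (Q (Q (T v))) = c i * (c i * (complex_of_real (l i) * ip (e i) v))"
        using i v TV lin_ops_in[OF Qlin] by (simp add: ipQ) (simp add: Tv ip_basis_coords)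
      then show "ip (e i) (Q (Q (T v))) = ip (e i) v"
        using c2[OF i] by (metis mult.assoc mult_1)
    qed
    finally show "Q (Q (T v)) = v" using expand[OF v] by simp
  qed (fact Qlin)
  have uniq: "Q' = Q" if "?P Q'" for Q'
  proof (rule lin_ops_eqI)
    fix v assume v: "v \<in> V"
    have "Q' (e i) = Q (e i)" if i: "i \<in> I" for i
      using inv_sqrt_unique_aux[of Q' T "e i" "l i"] inv_sqrt_unique_aux[of Q T "e i" "l i"] \<open>?P Q'\<close> PQ diag i
      by simp
    then show "Q' v = Q v"
      using linear_on_eqI[OF vector_space_axioms lin_ops_linear lin_ops_linear _ v] that PQ by blast
  qed (use that PQ in auto)
  have eq: "inv_sqrt s V ip T = Q"
    unfolding inv_sqrt_def by (rule the_equality[of ?P, OF PQ uniq])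
  then show "inv_sqrt s V ip T \<in> lin_ops s V" using PQ by simp
  show "inv_sqrt s V ip T v = s (complex_of_real (1 / sqrt t)) v"
    if "v \<in> V" "T v = s (complex_of_real t) v" "t > 0"
    unfolding eq by (rule inv_sqrt_unique_aux[of Q T]) (use that PQ in blast)+
qed

subsection \<open>The orthogonal complement of a basis vector\<close>

lemma onb_space_complement:
  assumes "o' \<in> I"
  shows "onb_space s {v \<in> V. ip (e o') v = 0} ip (I - {o'}) e"
proof unfold_locales
  show "finite (I - {o'})" using finite_I by simp
  have sub: "subspace {v \<in> V. ip (e o') v = 0}"
    using assms by (auto simp: subspace_def ip_add_right ip_scale_right)
       (metis ip_scale_right basis_in mult_zero_left scale_zero_left)
  show "{v \<in> V. ip (e o') v = 0} = span (e ` (I - {o'}))"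
  proof
    show "span (e ` (I - {o'})) \<subseteq> {v \<in> V. ip (e o') v = 0}"
      by (rule span_minimal[OF _ sub]) (use assms in \<open>auto simp: ip_basis\<close>)
    show "{v \<in> V. ip (e o') v = 0} \<subseteq> span (e ` (I - {o'}))"
    proof
      fix v assume "v \<in> {v \<in> V. ip (e o') v = 0}"
      then have eq: "v = (\<Sum>i\<in>I - {o'}. s (ip (e i) v) (e i))"
        using expand[of v] sum.remove[OF finite_I assms, of "\<lambda>i. s (ip (e i) v) (e i)"] by simp
      then show "v \<in> span (e ` (I - {o'}))"
        by (subst eq) (intro span_sum span_scale span_base imageI)
    qed
  qed
  fix a b :: "'i \<Rightarrow> complex"
  have ext: "(\<Sum>i\<in>I - {o'}. s (a i) (e i)) = (\<Sum>i\<in>I. s (if i = o' then 0 else a i) (e i))" for a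
    using sum.remove[OF finite_I assms, of "\<lambda>i. s (if i = o' then 0 else a i) (e i)"] by simp
  show "ip (\<Sum>i\<in>I - {o'}. s (a i) (e i)) (\<Sum>i\<in>I - {o'}. s (b i) (e i)) = (\<Sum>i\<in>I - {o'}. cnj (a i) * b i)"
    unfolding ext ip_coords
    using sum.remove[OF finite_I assms, of "\<lambda>i. cnj (if i = o' then 0 else a i) * (if i = o' then 0 else b i)"]
    by simp
qed

subsection \<open>Commutants and von Neumann algebras\<close>

lemma commutant_iff:
  "T \<in> commutant s V M \<longleftrightarrow> T \<in> lin_ops s V \<and> (\<forall>X\<in>M. \<forall>v\<in>V. T (X v) = X (T v))"
  by (auto simp: commutant_def compose_def fun_eq_iff restrict_def)

lemma commutant_triple:
  assumes "M \<subseteq> lin_ops s V"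
  shows "commutant s V (commutant s V (commutant s V M)) = commutant s V M"
proof -
  have inc: "N \<subseteq> commutant s V (commutant s V N)" if "N \<subseteq> lin_ops s V" for N
    using that by (auto simp: commutant_iff)
  have anti: "commutant s V N' \<subseteq> commutant s V N" if "N \<subseteq> N'" for N N'
    using that unfolding commutant_iff subset_iff by blast
  have "commutant s V M \<subseteq> lin_ops s V" by (simp add: commutant_def)
  then show ?thesis
    by (intro antisym anti[OF inc[OF assms]] inc)
qed

text \<open>
  If \<open>X\<close> commutes with \<open>g\<^sup>*\<close>, then \<open>X\<^sup>*\<close> commutes with \<open>g\<close>; as \<open>G\<close> contains \<open>g\<^sup>*\<close> along
  with \<open>g\<close>, its commutant is closed under adjoints. This is the tool for bounding a generated algebra
  from above.
\<close>

lemma von_neumann_algebra_commutant: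
  assumes G: "G \<subseteq> lin_ops s V" "\<And>X. X \<in> G \<Longrightarrow> adj s V ip X \<in> G"
  shows "von_neumann_algebra s V ip (commutant s V G)"
  unfolding von_neumann_algebra_def
proof (intro conjI ballI commutant_triple G(1))
  show "commutant s V G \<subseteq> lin_ops s V" by (auto simp: commutant_def)
  fix X assume "X \<in> commutant s V G"
  then have X: "X \<in> lin_ops s V" and comm: "\<And>g v. g \<in> G \<Longrightarrow> v \<in> V \<Longrightarrow> X (g v) = g (X v)"
    by (auto simp: commutant_iff)
  show "adj s V ip X \<in> commutant s V G"
    unfolding commutant_iff
  proof (intro conjI ballI)
    show A: "adj s V ip X \<in> lin_ops s V" by (rule adj_in_lin_ops[OF X])
    fix g v assume g: "g \<in> G" and v: "v \<in> V"
    have g': "g \<in> lin_ops s V" using g G by auto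
    have in_V: "g u \<in> V" "adj s V ip g u \<in> V" "X u \<in> V" "adj s V ip X u \<in> V" if "u \<in> V" for u
      using that g' X A adj_in_lin_ops[OF g'] lin_ops_in by blast+
    show "adj s V ip X (g v) = g (adj s V ip X v)"
    proof (rule ip_nondegenerate)
      fix u assume u: "u \<in> V"
      have "ip u (adj s V ip X (g v)) = ip (adj s V ip g (X u)) v"
        using u v in_V by (simp add: ip_adj[OF X] ip_adj_left[OF g'])
      also have "\<dots> = ip (X (adj s V ip g u)) v"
        using comm[OF G(2)[OF g] u] by simp
      also have "\<dots> = ip u (g (adj s V ip X v))"
        using u v in_V by (simp add: ip_adj_left[OF g'] flip: ip_adj[OF X])
      finally show "ip u (adj s V ip X (g v)) = ip u (g (adj s V ip X v))" .
    qed (use v in_V in auto)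
  qed
qed

lemma commutant_closed:
  assumes "N \<subseteq> lin_ops s V"
  shows commutant_id: "(\<lambda>v\<in>V. v) \<in> commutant s V N"
    and commutant_compose: "X \<in> commutant s V N \<Longrightarrow> Y \<in> commutant s V N \<Longrightarrow> compose V X Y \<in> commutant s V N"
    and commutant_sum: "\<lbrakk>\<And>k. k \<in> K \<Longrightarrow> Z k \<in> commutant s V N\<rbrakk> \<Longrightarrow>
           (\<lambda>v\<in>V. \<Sum>k\<in>K. s (c k) (Z k v)) \<in> commutant s V N"
proof -
  have in_V: "\<And>X v. X \<in> N \<Longrightarrow> v \<in> V \<Longrightarrow> X v \<in> V" "\<And>X v. X \<in> commutant s V N \<Longrightarrow> v \<in> V \<Longrightarrow> X v \<in> V"
    using assms lin_ops_in unfolding commutant_iff by blast+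
  show "(\<lambda>v\<in>V. v) \<in> commutant s V N"
    using in_V by (auto simp: commutant_iff lin_ops_def)
  show "compose V X Y \<in> commutant s V N" if "X \<in> commutant s V N" "Y \<in> commutant s V N"
    using that in_V(1) in_V(2)[OF that(1)] in_V(2)[OF that(2)]
    by (auto simp: commutant_iff lin_ops_iff linear_on_def compose_def)
  show "(\<lambda>v\<in>V. \<Sum>k\<in>K. s (c k) (Z k v)) \<in> commutant s V N"
    if Z: "\<And>k. k \<in> K \<Longrightarrow> Z k \<in> commutant s V N"
  proof -
    have ZV: "Z k v \<in> V" if "k \<in> K" "v \<in> V" for k v
      using in_V(2)[OF Z] that by blast
    have lin: "linear_on s s V (Z k)" if "k \<in> K" for k
      using Z[OF that] by (simp add: commutant_iff lin_ops_linear)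
    have "(\<Sum>k\<in>K. s (c k) (Z k (X v))) = X (\<Sum>k\<in>K. s (c k) (Z k v))" if "X \<in> N" "v \<in> V" for X v
    proof (cases "finite K")
      case True
      have "linear_on s s V X" using assms that lin_ops_linear by auto
      from linear_on_sum[OF vector_space_axioms vector_space_axioms subspace_V this True, of "\<lambda>k. Z k v" c]
      show ?thesis using Z that ZV by (simp add: commutant_iff)
    next
      case False
      have "X 0 = 0"
        using assms that linear_on_scale[of s s V X 0 0] lin_ops_linear by auto
      then show ?thesis using False by simp
    qed
    then show ?thesis
      using in_V(1)
      by (auto simp: commutant_iff lin_ops_iff linear_on_def V_sum ZV linear_on_add[OF lin]
          linear_on_scale[OF lin] scale_right_distrib sum.distrib scale_sum_right mult.commute)
  qed
qed

lemma vN_generated_incl: "G \<subseteq> vN_generated s V ip G"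
  by (auto simp: vN_generated_def)

lemma vN_generated_subset: "von_neumann_algebra s V ip M \<Longrightarrow> G \<subseteq> M \<Longrightarrow> vN_generated s V ip G \<subseteq> M"
  by (auto simp: vN_generated_def)

text \<open>
  A von Neumann algebra is the commutant of its commutant, so the closure properties of commutants hold
  for it and hence for intersections of such algebras.
\<close>

lemma vN_generated_closed:
  shows vN_generated_id: "(\<lambda>v\<in>V. v) \<in> vN_generated s V ip G"
    and vN_generated_adj: "X \<in> vN_generated s V ip G \<Longrightarrow> adj s V ip X \<in> vN_generated s V ip G"
    and vN_generated_compose: "X \<in> vN_generated s V ip G \<Longrightarrow> Y \<in> vN_generated s V ip G \<Longrightarrow>
           compose V X Y \<in> vN_generated s V ip G"
    and vN_generated_sum: "\<lbrakk>\<And>k. k \<in> K \<Longrightarrow> Z k \<in> vN_generated s V ip G\<rbrakk> \<Longrightarrow>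
           (\<lambda>v\<in>V. \<Sum>k\<in>K. s (c k) (Z k v)) \<in> vN_generated s V ip G"
proof -
  have sub: "commutant s V M \<subseteq> lin_ops s V" for M by (auto simp: commutant_def)
  have M: "commutant s V (commutant s V M) = M" if "von_neumann_algebra s V ip M" for M
    using that by (simp add: von_neumann_algebra_def)
  show "(\<lambda>v\<in>V. v) \<in> vN_generated s V ip G"
    unfolding vN_generated_def using commutant_id[OF sub] M by blast
  show "adj s V ip X \<in> vN_generated s V ip G" if "X \<in> vN_generated s V ip G"
    using that by (auto simp: vN_generated_def von_neumann_algebra_def)
  show "compose V X Y \<in> vN_generated s V ip G"
    if "X \<in> vN_generated s V ip G" "Y \<in> vN_generated s V ip G"
    using that commutant_compose[OF sub] M unfolding vN_generated_def by (simp add: Ball_def) metis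
  show "(\<lambda>v\<in>V. \<Sum>k\<in>K. s (c k) (Z k v)) \<in> vN_generated s V ip G"
    if Z: "\<And>k. k \<in> K \<Longrightarrow> Z k \<in> vN_generated s V ip G"
    unfolding vN_generated_def
  proof (intro InterI)
    fix M assume "M \<in> {M. von_neumann_algebra s V ip M \<and> G \<subseteq> M}"
    then have M': "commutant s V (commutant s V M) = M" and ZM: "\<And>k. k \<in> K \<Longrightarrow> Z k \<in> M"
      using M Z by (auto simp: vN_generated_def)
    show "(\<lambda>v\<in>V. \<Sum>k\<in>K. s (c k) (Z k v)) \<in> M"
      using commutant_sum[OF sub, of K Z M c] ZM unfolding M' by blast
  qed
qed

end

section \<open>The biased hypercube\<close>

(* Otherwise the simplifier turns {1..n} into {Suc 0..n}, which no longer matches the facts below. *)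
declare One_nat_def [simp del]

lemma sum_fun_apply: "(\<Sum>i\<in>K. g i) \<omega> = (\<Sum>i\<in>K. g i \<omega>)" for g :: "'i \<Rightarrow> 'a \<Rightarrow> complex"
  by (induction K rule: infinite_finite_induct) auto

lemma finite_measure_nu1: "finite_measure (nu1 m)"
  by (rule finite_measureI) (simp add: nu1_def space_point_measure emeasure_point_measure_finite)

lemma integrable_nu1: "integrable (nu1 m) g" for g :: "int \<Rightarrow> complex"
  by (simp add: nu1_def integrable_point_measure_finite)

lemma integral_nu1:
  fixes g :: "int \<Rightarrow> complex"
  assumes "m > 0"
  shows "(LINT t|nu1 m. g t) =
    (complex_of_real (m powi (-2)) * g 1 + complex_of_real (m powi 2) * g (-1)) /
      complex_of_real (m powi (-2) + m powi 2)"
proof -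
  have "m powi (-2) + m powi 2 > 0" "m powi (-2) \<ge> 0" "m powi 2 \<ge> 0"
    using assms by (auto intro!: add_pos_pos)
  then show ?thesis
    unfolding nu1_def
    by (subst lebesgue_integral_point_measure_finite)
       (auto simp: scaleR_conv_of_real add_divide_distrib)
qed

locale hypercube =
  fixes n :: nat and \<mu> :: "nat \<Rightarrow> real"
  assumes \<mu>_pos: "i \<in> {1..n} \<Longrightarrow> \<mu> i > 0"
begin

definition zeta1 :: "nat \<Rightarrow> int \<Rightarrow> complex" where
  "zeta1 j t = complex_of_real (if t = 1 then \<mu> j powi 2 else - (\<mu> j powi (-2)))"

lemma space_nu: "space (nu n \<mu>) = Omega n"
  by (simp add: nu_def Omega_def space_PiM nu1_def space_point_measure)

lemma product_sigma_finite_nu1: "product_sigma_finite (\<lambda>j. nu1 (\<mu> j))"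
  by (simp add: product_sigma_finite_def finite_measure_nu1 finite_measure.axioms(1))

lemma zeta_eq: "\<omega> \<in> Omega n \<Longrightarrow> zeta n \<mu> A \<omega> = (\<Prod>j\<in>A. zeta1 j (\<omega> j))"
  by (simp add: zeta_def zeta1_def)

lemma zeta_product_eq:
  assumes "A \<subseteq> {1..n}" "B \<subseteq> {1..n}" "\<omega> \<in> Omega n"
  shows "cnj (zeta n \<mu> A \<omega>) * zeta n \<mu> B \<omega> =
    (\<Prod>j\<in>{1..n}. (if j \<in> A then zeta1 j (\<omega> j) else 1) * (if j \<in> B then zeta1 j (\<omega> j) else 1))"
proof -
  have ind: "(\<Prod>j\<in>{1..n}. if j \<in> C then zeta1 j (\<omega> j) else 1) = (\<Prod>j\<in>C. zeta1 j (\<omega> j))" if "C \<subseteq> {1..n}" for C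
    using that by (simp add: prod.inter_restrict[symmetric] Int_absorb1)
  show ?thesis
    unfolding prod.distrib ind[OF assms(1)] ind[OF assms(2)] zeta_eq[OF assms(3)]
    by (simp add: zeta1_def)
qed

lemma integrable_zeta_product:
  assumes "A \<subseteq> {1..n}" "B \<subseteq> {1..n}"
  shows "integrable (nu n \<mu>) (\<lambda>\<omega>. cnj (zeta n \<mu> A \<omega>) * zeta n \<mu> B \<omega>)"
proof -
  interpret product_sigma_finite "\<lambda>j. nu1 (\<mu> j)" by (rule product_sigma_finite_nu1)
  have "integrable (nu n \<mu>)
      (\<lambda>\<omega>. \<Prod>j\<in>{1..n}. (if j \<in> A then zeta1 j (\<omega> j) else 1) * (if j \<in> B then zeta1 j (\<omega> j) else 1))"
    unfolding nu_def by (rule product_integrable_prod) (auto intro: integrable_nu1)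
  then show ?thesis
    by (subst Bochner_Integration.integrable_cong[OF refl zeta_product_eq[OF assms]]) (auto simp: space_nu)
qed

text \<open>
  The measure and the integrand are products over the coordinates, and the coordinate function
  \<open>\<zeta>\<^sub>j\<close> has mean \<open>0\<close> and second moment \<open>1\<close> under \<open>\<nu>\<^sub>j\<close>. The two functions are orthogonal because a
  coordinate in exactly one of \<open>A\<close> and \<open>B\<close> contributes a vanishing mean.
\<close>

lemma integral_zeta_product:
  assumes "A \<subseteq> {1..n}" "B \<subseteq> {1..n}"
  shows "(LINT \<omega>|nu n \<mu>. cnj (zeta n \<mu> A \<omega>) * zeta n \<mu> B \<omega>) = (if A = B then 1 else 0)"
proof -
  interpret product_sigma_finite "\<lambda>j. nu1 (\<mu> j)" by (rule product_sigma_finite_nu1)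
  let ?h = "\<lambda>j t. (if j \<in> A then zeta1 j t else 1) * (if j \<in> B then zeta1 j t else 1)"
  have h: "(LINT t|nu1 (\<mu> j). ?h j t) = (if j \<in> A \<longleftrightarrow> j \<in> B then 1 else 0)" if "j \<in> {1..n}" for j
  proof -
    define a where "a = \<mu> j powi 2"
    have a: "a > 0" "\<mu> j powi (-2) = 1 / a"
      using \<mu>_pos[OF that] by (auto simp: a_def power_int_minus divide_simps)
    then have "a + a * (a * a) > 0"
      by (intro add_pos_pos mult_pos_pos) auto
    then have "complex_of_real (a + a * (a * a)) \<noteq> 0" "1 + complex_of_real a * complex_of_real a \<noteq> 0"
      using a(1) by (auto simp: complex_eq_iff add_pos_pos less_imp_neq[symmetric])
    then show ?thesis
      using a(1) unfolding integral_nu1[OF \<mu>_pos[OF that]] zeta1_def a_def[symmetric] a(2)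
      by (auto simp: field_simps)
  qed
  have "(LINT \<omega>|nu n \<mu>. cnj (zeta n \<mu> A \<omega>) * zeta n \<mu> B \<omega>) = (LINT \<omega>|nu n \<mu>. (\<Prod>j\<in>{1..n}. ?h j (\<omega> j)))"
    by (rule Bochner_Integration.integral_cong[OF refl zeta_product_eq[OF assms]]) (simp add: space_nu)
  also have "\<dots> = (\<Prod>j\<in>{1..n}. (LINT t|nu1 (\<mu> j). ?h j t))"
    unfolding nu_def by (rule product_integral_prod) (auto intro: integrable_nu1)
  also have "\<dots> = (\<Prod>j\<in>{1..n}. if j \<in> A \<longleftrightarrow> j \<in> B then 1 else 0)"
    by (intro prod.cong refl h)
  also have "\<dots> = (if A = B then 1 else 0)"
  proof (cases "A = B")
    case False
    then obtain j where "j \<in> {1..n}" "\<not> (j \<in> A \<longleftrightarrow> j \<in> B)" using assms by blast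
    then have "(\<Prod>j\<in>{1..n}. if j \<in> A \<longleftrightarrow> j \<in> B then 1 else 0) = (0 :: complex)"
      by (intro prod_zero) (auto intro: bexI[of _ j])
    then show ?thesis using False by simp
  qed simp
  finally show ?thesis .
qed

lemma zeta_in: "zeta n \<mu> A \<in> L_Omega n"
  by (simp add: L_Omega_def zeta_def)

lemma subspace_L_Omega: "fn.subspace (L_Omega n)"
  by (auto simp: fn.subspace_def L_Omega_def fn_scale_def)

text \<open>
  The sum factors as the product of \<open>1 + \<zeta>\<^sub>j(\<omega>') \<zeta>\<^sub>j(\<omega>)\<close> over \<open>j\<close>. The two values of \<open>\<zeta>\<^sub>j\<close>
  multiply to \<open>-1\<close>, so a factor vanishes exactly where \<open>\<omega>\<close> and \<open>\<omega>'\<close> differ. Suitably scaled, this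
  kernel is therefore a point mass, which is how the \<open>\<zeta>\<^sub>A\<close> are seen to span all functions.
\<close>

lemma zeta_kernel:
  assumes "\<omega> \<in> Omega n" "\<omega>' \<in> Omega n"
  shows "(\<Sum>A\<in>Pow {1..n}. zeta n \<mu> A \<omega>' * zeta n \<mu> A \<omega>) = 0 \<longleftrightarrow> \<omega> \<noteq> \<omega>'"
proof -
  have "(\<Sum>A\<in>Pow {1..n}. zeta n \<mu> A \<omega>' * zeta n \<mu> A \<omega>) = (\<Prod>j\<in>{1..n}. zeta1 j (\<omega>' j) * zeta1 j (\<omega> j) + 1)"
    using assms by (simp add: prod_add zeta_eq prod.distrib)
  moreover have "zeta1 j (\<omega>' j) * zeta1 j (\<omega> j) + 1 = 0 \<longleftrightarrow> \<omega> j \<noteq> \<omega>' j" if j: "j \<in> {1..n}" for j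
  proof -
    have mu: "\<mu> j > 0" by (rule \<mu>_pos[OF j])
    have val: "\<omega> j \<in> {-1, 1}" "\<omega>' j \<in> {-1, 1}"
      using assms j by (auto simp: Omega_def PiE_def Pi_def)
    define a where "a = \<mu> j powi 2"
    have a: "a > 0" "\<mu> j powi (-2) = 1 / a"
      using mu by (auto simp: a_def power_int_minus divide_simps)
    have "a * a > 0"
      using a(1) by simp
    then have "complex_of_real (a * a + 1) \<noteq> 0" "a * a \<noteq> - 1"
      by (metis add_pos_pos less_irrefl of_real_eq_0_iff zero_less_one, linarith)
    then show ?thesis
      using val a(1) unfolding zeta1_def a_def[symmetric] a(2)
      by (auto simp: field_simps)
  qed
  moreover have "(\<exists>j\<in>{1..n}. \<omega> j \<noteq> \<omega>' j) \<longleftrightarrow> \<omega> \<noteq> \<omega>'"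
    using assms PiE_ext[of \<omega> "{1..n}" "\<lambda>_. {-1, 1}" \<omega>'] by (auto simp: Omega_def)
  ultimately show ?thesis
    by (simp add: prod_zero_iff)
qed

lemma span_zeta: "L_Omega n = fn.span (zeta n \<mu> ` Pow {1..n})"
proof
  show "fn.span (zeta n \<mu> ` Pow {1..n}) \<subseteq> L_Omega n"
    by (rule fn.span_minimal[OF _ subspace_L_Omega]) (auto simp: zeta_in)
  show "L_Omega n \<subseteq> fn.span (zeta n \<mu> ` Pow {1..n})"
  proof
    fix f assume f: "f \<in> L_Omega n"
    define K where "K \<omega> \<omega>' = (\<Sum>A\<in>Pow {1..n}. zeta n \<mu> A \<omega>' * zeta n \<mu> A \<omega>)" for \<omega> \<omega>'
    have fin: "finite (Omega n)" by (simp add: Omega_def finite_PiE)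
    have "f = (\<Sum>\<omega>'\<in>Omega n. fn_scale (f \<omega>' / K \<omega>' \<omega>')
                (\<Sum>A\<in>Pow {1..n}. fn_scale (zeta n \<mu> A \<omega>') (zeta n \<mu> A)))" (is "f = ?g")
    proof
      fix \<omega>
      have g: "?g \<omega> = (\<Sum>\<omega>'\<in>Omega n. f \<omega>' / K \<omega>' \<omega>' * K \<omega> \<omega>')"
        by (simp add: sum_fun_apply fn_scale_def K_def)
      show "f \<omega> = ?g \<omega>"
      proof (cases "\<omega> \<in> Omega n")
        case True
        have "?g \<omega> = (\<Sum>\<omega>'\<in>Omega n. if \<omega>' = \<omega> then f \<omega> else 0)"
          unfolding g using True zeta_kernel[OF True]
          by (intro sum.cong) (auto simp: K_def)
        then show ?thesis using True fin by simp
      next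
        case False
        then have "K \<omega> \<omega>' = 0" for \<omega>'
          by (simp add: K_def zeta_def)
        then show ?thesis using g f False by (simp add: L_Omega_def)
      qed
    qed
    moreover have "?g \<in> fn.span (zeta n \<mu> ` Pow {1..n})"
      by (intro fn.span_sum fn.span_scale fn.span_base imageI)
    ultimately show "f \<in> fn.span (zeta n \<mu> ` Pow {1..n})" by simp
  qed
qed

sublocale L: onb_space fn_scale "L_Omega n" "L_ip n \<mu>" "Pow {1..n}" "zeta n \<mu>"
proof unfold_locales
  show "finite (Pow {1..n})" by simp
  show "L_Omega n = fn.span (zeta n \<mu> ` Pow {1..n})" by (rule span_zeta)
  fix a b :: "nat set \<Rightarrow> complex"
  let ?P = "Pow {1..n}"
  let ?v = "\<lambda>a. \<Sum>A\<in>?P. fn_scale (a A) (zeta n \<mu> A)"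
  have "L_ip n \<mu> (?v a) (?v b) =
      (LINT \<omega>|nu n \<mu>. (\<Sum>A\<in>?P. \<Sum>B\<in>?P. cnj (a A) * b B * (cnj (zeta n \<mu> A \<omega>) * zeta n \<mu> B \<omega>)))"
    unfolding L_ip_def
    by (intro arg_cong[where f = "integral\<^sup>L (nu n \<mu>)"] ext)
       (simp add: sum_fun_apply fn_scale_def sum_product, intro sum.cong refl, simp add: mult_ac)
  also have "\<dots> = (\<Sum>A\<in>?P. \<Sum>B\<in>?P. cnj (a A) * b B * (if A = B then 1 else 0))"
    by (subst Bochner_Integration.integral_sum, force intro!: integrable_zeta_product Bochner_Integration.integrable_sum)
       (intro sum.cong refl, subst Bochner_Integration.integral_sum,
        force intro!: integrable_zeta_product, simp add: integral_zeta_product)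
  also have "\<dots> = (\<Sum>A\<in>?P. cnj (a A) * b A)"
    by (simp add: if_distrib[where f = "\<lambda>t. _ * t"] sum.delta' cong: if_cong)
  finally show "L_ip n \<mu> (?v a) (?v b) = (\<Sum>A\<in>?P. cnj (a A) * b A)" .
qed

lemma ip_zeta_empty: "L_ip n \<mu> (zeta n \<mu> {}) f = (LINT \<omega>|nu n \<mu>. f \<omega>)"
  unfolding L_ip_def by (rule Bochner_Integration.integral_cong) (auto simp: zeta_def space_nu)

lemma L_Omega0_eq: "L_Omega0 n \<mu> = {f \<in> L_Omega n. L_ip n \<mu> (zeta n \<mu> {}) f = 0}"
  by (simp add: L_Omega0_def ip_zeta_empty)

sublocale L0: onb_space fn_scale "L_Omega0 n \<mu>" "L_ip n \<mu>" "Pow {1..n} - {{}}" "zeta n \<mu>"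
  unfolding L_Omega0_eq by (rule L.onb_space_complement) simp

lemma L_lin_ops_lin_ext:
  assumes "\<And>A. A \<subseteq> {1..n} \<Longrightarrow> g A \<in> L_Omega n"
  shows "(\<lambda>f\<in>L_Omega n. lin_ext fn_scale fn_scale (Pow {1..n}) (zeta n \<mu>) g f) \<in> lin_ops fn_scale (L_Omega n)"
proof -
  have lin: "linear_on fn_scale fn_scale (L_Omega n) (lin_ext fn_scale fn_scale (Pow {1..n}) (zeta n \<mu>) g)"
    by (rule linear_on_lin_ext[OF fn.vector_space_axioms fn.vector_space_axioms L.independent_basis
        eq_refl[OF L.V_eq]])
  have "lin_ext fn_scale fn_scale (Pow {1..n}) (zeta n \<mu>) g f \<in> L_Omega n" if "f \<in> L_Omega n" for f
    unfolding L.lin_ext_eq[OF fn.vector_space_axioms that] using assms by (intro L.V_sum L.V_scale) auto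
  then show ?thesis
    using lin by (auto simp: lin_ops_iff linear_on_def)
qed

lemma L_lin_ext_zeta: "A \<subseteq> {1..n} \<Longrightarrow>
    vector_space s' \<Longrightarrow> lin_ext fn_scale s' (Pow {1..n}) (zeta n \<mu>) g (zeta n \<mu> A) = g A"
  by (rule lin_ext_basis[OF fn.vector_space_axioms _ L.finite_I L.inj_on_basis L.independent_basis]) auto

lemma D_op_lin: "D_op n \<mu> j \<in> lin_ops fn_scale (L_Omega n)"
  unfolding D_op_def by (rule L_lin_ops_lin_ext) (auto simp: zeta_in)

lemma D_op_zeta: "A \<subseteq> {1..n} \<Longrightarrow> D_op n \<mu> j (zeta n \<mu> A) = (if j \<in> A then zeta n \<mu> (A - {j}) else 0)"
  by (simp add: D_op_def zeta_in L_lin_ext_zeta fn.vector_space_axioms)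

lemma D_adj:
  assumes "j \<in> {1..n}"
  shows "adj fn_scale (L_Omega n) (L_ip n \<mu>) (D_op n \<mu> j) \<in> lin_ops fn_scale (L_Omega n)"
    and "A \<subseteq> {1..n} \<Longrightarrow> adj fn_scale (L_Omega n) (L_ip n \<mu>) (D_op n \<mu> j) (zeta n \<mu> A) =
           (if j \<in> A then 0 else zeta n \<mu> (insert j A))"
proof -
  define S where "S = (\<lambda>f\<in>L_Omega n. lin_ext fn_scale fn_scale (Pow {1..n}) (zeta n \<mu>)
    (\<lambda>A. if j \<in> A then 0 else zeta n \<mu> (insert j A)) f)"
  have Slin: "S \<in> lin_ops fn_scale (L_Omega n)"
    unfolding S_def by (rule L_lin_ops_lin_ext) (auto simp: zeta_in)
  have Sz: "S (zeta n \<mu> A) = (if j \<in> A then 0 else zeta n \<mu> (insert j A))" if "A \<subseteq> {1..n}" for A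
    using that by (simp add: S_def zeta_in L_lin_ext_zeta fn.vector_space_axioms)
  have ip0: "L_ip n \<mu> 0 f = 0" "L_ip n \<mu> f 0 = 0" for f
    by (simp_all add: L_ip_def)
  have "adj fn_scale (L_Omega n) (L_ip n \<mu>) (D_op n \<mu> j) = S"
  proof (rule L.adj_eq_on_basisI[OF D_op_lin Slin])
    fix A B assume AB: "A \<in> Pow {1..n}" "B \<in> Pow {1..n}"
    have ip: "L_ip n \<mu> (zeta n \<mu> A) (zeta n \<mu> B) = (if A = B then 1 else 0)"
      if "A \<subseteq> {1..n}" "B \<subseteq> {1..n}" for A B
      using that by (simp add: L.ip_basis)
    have "A - {j} \<subseteq> {1..n}" "insert j B \<subseteq> {1..n}" "A \<subseteq> {1..n}" "B \<subseteq> {1..n}"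
      using assms AB by auto
    then show "L_ip n \<mu> (D_op n \<mu> j (zeta n \<mu> A)) (zeta n \<mu> B) = L_ip n \<mu> (zeta n \<mu> A) (S (zeta n \<mu> B))"
      by (auto simp: D_op_zeta Sz ip0 ip simp del: insert_subset split: if_splits)
  qed
  then show "adj fn_scale (L_Omega n) (L_ip n \<mu>) (D_op n \<mu> j) \<in> lin_ops fn_scale (L_Omega n)"
    and "A \<subseteq> {1..n} \<Longrightarrow> adj fn_scale (L_Omega n) (L_ip n \<mu>) (D_op n \<mu> j) (zeta n \<mu> A) =
           (if j \<in> A then 0 else zeta n \<mu> (insert j A))"
    using Slin Sz by auto
qed

lemma N_op_linear: "linear_on fn_scale fn_scale (L_Omega0 n \<mu>) (N_op n \<mu>)"
proof -
  have "linear_on fn_scale fn_scale (L_Omega n) (N_op n \<mu>)"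
    unfolding linear_on_def N_op_def
    by (auto simp: linear_on_add[OF lin_ops_linear[OF D_op_lin]] linear_on_add[OF lin_ops_linear[OF D_adj(1)]]
        linear_on_scale[OF lin_ops_linear[OF D_op_lin]] linear_on_scale[OF lin_ops_linear[OF D_adj(1)]]
        lin_ops_in[OF D_op_lin] sum.distrib fn.scale_sum_right)
  then show ?thesis
    by (rule linear_on_subset) (auto simp: L_Omega0_def)
qed

lemma N_op_zeta:
  assumes "A \<subseteq> {1..n}"
  shows "N_op n \<mu> (zeta n \<mu> A) = fn_scale (complex_of_real (card A)) (zeta n \<mu> A)"
proof -
  have "N_op n \<mu> (zeta n \<mu> A) = (\<Sum>j\<in>{1..n}. if j \<in> A then zeta n \<mu> A else 0)"
    unfolding N_op_def using assms
    by (auto simp: zeta_in D_op_zeta intro!: sum.cong)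
       (auto simp: D_adj(2) subset_iff insert_absorb linear_on_scale[OF lin_ops_linear[OF D_adj(1)], of _ 0 0, simplified])
  also have "\<dots> = (\<Sum>j\<in>A. zeta n \<mu> A)"
    using assms by (simp add: sum.inter_restrict[symmetric] Int_absorb1)
  also have "\<dots> = fn_scale (complex_of_real (card A)) (zeta n \<mu> A)"
    by (auto simp: fun_eq_iff sum_fun_apply fn_scale_def)
  finally show ?thesis .
qed

lemma N_inv_sqrt:
  shows "inv_sqrt fn_scale (L_Omega0 n \<mu>) (L_ip n \<mu>) (N_op n \<mu>) \<in> lin_ops fn_scale (L_Omega0 n \<mu>)"
    and "A \<in> Pow {1..n} - {{}} \<Longrightarrow> inv_sqrt fn_scale (L_Omega0 n \<mu>) (L_ip n \<mu>) (N_op n \<mu>) (zeta n \<mu> A) =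
           fn_scale (complex_of_real (1 / sqrt (card A))) (zeta n \<mu> A)"
proof -
  have diag: "N_op n \<mu> (zeta n \<mu> A) = fn_scale (complex_of_real (real (card A))) (zeta n \<mu> A)"
    "0 < real (card A)" if "A \<in> Pow {1..n} - {{}}" for A
    using that N_op_zeta finite_subset[of A "{1..n}"] by (auto simp: card_gt_0_iff)
  show "inv_sqrt fn_scale (L_Omega0 n \<mu>) (L_ip n \<mu>) (N_op n \<mu>) \<in> lin_ops fn_scale (L_Omega0 n \<mu>)"
    by (rule L0.inv_sqrt_props(1)[OF N_op_linear diag])
  show "inv_sqrt fn_scale (L_Omega0 n \<mu>) (L_ip n \<mu>) (N_op n \<mu>) (zeta n \<mu> A) =
           fn_scale (complex_of_real (1 / sqrt (card A))) (zeta n \<mu> A)" if "A \<in> Pow {1..n} - {{}}"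
    by (rule L0.inv_sqrt_props(2)[OF N_op_linear diag _ diag[OF that]]) (use that in auto)
qed

text \<open>
  The mean of \<open>f\<close> vanishes, hence the sum runs over nonempty sets, on which \<open>N\<close> is invertible.
\<close>

lemma R_op_expand:
  assumes f: "f \<in> L_Omega0 n \<mu>"
  shows "R_op n \<mu> j f = (\<Sum>A\<in>Pow {1..n} - {{}}.
     fn_scale (complex_of_real ((\<mu> j powi (-2) + \<mu> j powi 2) / 2 / sqrt (card A)) * L_ip n \<mu> (zeta n \<mu> A) f)
       (if j \<in> A then zeta n \<mu> (A - {j}) else 0))"
proof -
  let ?P = "Pow {1..n} - {{}}"
  let ?k = "complex_of_real ((\<mu> j powi (-2) + \<mu> j powi 2) / 2)"
  let ?c = "\<lambda>A. L_ip n \<mu> (zeta n \<mu> A) f" and ?r = "\<lambda>A. complex_of_real (1 / sqrt (card A))"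
  have "inv_sqrt fn_scale (L_Omega0 n \<mu>) (L_ip n \<mu>) (N_op n \<mu>) f =
      (\<Sum>A\<in>?P. fn_scale (?c A * ?r A) (zeta n \<mu> A))"
    unfolding L0.linear_on_expand[OF fn.vector_space_axioms lin_ops_linear[OF N_inv_sqrt(1)] f]
    by (intro sum.cong refl) (simp add: N_inv_sqrt(2))
  then have "R_op n \<mu> j f = fn_scale ?k (D_op n \<mu> j (\<Sum>A\<in>?P. fn_scale (?c A * ?r A) (zeta n \<mu> A)))"
    using f by (simp add: R_op_def)
  also have "D_op n \<mu> j (\<Sum>A\<in>?P. fn_scale (?c A * ?r A) (zeta n \<mu> A)) =
      (\<Sum>A\<in>?P. fn_scale (?c A * ?r A) (if j \<in> A then zeta n \<mu> (A - {j}) else 0))"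
    by (subst linear_on_sum[OF fn.vector_space_axioms fn.vector_space_axioms L.subspace_V lin_ops_linear[OF D_op_lin]])
       (auto simp: D_op_zeta zeta_in intro!: sum.cong)
  finally show ?thesis
    by (simp add: fn.scale_sum_right mult_ac)
qed

end

section \<open>Matrices\<close>

lemma mat_scale_mult_left [simp]: "mat_scale c A ** B = mat_scale c (A ** B)"
  and mat_scale_mult_right [simp]: "A ** mat_scale c B = mat_scale c (A ** B)"
  by (simp_all add: mat_scale_def matrix_matrix_mult_def vec_eq_iff sum_distrib_left mult_ac)

lemma mat_mult_add: "(A + B) ** C = A ** C + B ** C" "C ** (A + B) = C ** A + C ** B"
  and mat_mult_diff: "(A - B) ** C = A ** C - B ** C" "C ** (A - B) = C ** A - C ** B"
  for A B C :: "complex^'m^'m"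
  by (simp_all add: matrix_matrix_mult_def vec_eq_iff algebra_simps sum.distrib sum_subtractf)

lemma mat_mult_minus [simp]: "(- A) ** C = - (A ** C)" "C ** (- A) = - (C ** A)"
  for A C :: "complex^'m^'m"
  by (simp_all add: matrix_matrix_mult_def vec_eq_iff sum_negf)

lemma mat_mult_sum: "(\<Sum>i\<in>K. g i) ** C = (\<Sum>i\<in>K. g i ** C)" "C ** (\<Sum>i\<in>K. g i) = (\<Sum>i\<in>K. C ** g i)"
  for C :: "complex^'m^'m"
  by (induction K rule: infinite_finite_induct) (simp_all add: mat_mult_add)

lemma mat_adj_mult: "mat_adj (A ** B) = mat_adj B ** mat_adj A"
  by (simp add: mat_adj_def transpose_def matrix_matrix_mult_def vec_eq_iff mult.commute)

lemma mat_adj_add: "mat_adj (A + B) = mat_adj A + mat_adj B"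
  and mat_adj_scale: "mat_adj (mat_scale c A) = mat_scale (cnj c) (mat_adj A)"
  and mat_adj_zero: "mat_adj 0 = 0"
  and mat_adj_one: "mat_adj (mat 1) = mat 1"
  by (auto simp: mat_adj_def mat_scale_def transpose_def vec_eq_iff mat_def)

lemma mat_adj_sum: "mat_adj (\<Sum>i\<in>K. g i) = (\<Sum>i\<in>K. mat_adj (g i))"
  by (induction K rule: infinite_finite_induct) (simp_all add: mat_adj_add mat_adj_zero)

lemma linear_on_compose:
  "linear_on s s V F \<Longrightarrow> linear_on s s' V G \<Longrightarrow> (\<And>v. v \<in> V \<Longrightarrow> F v \<in> V) \<Longrightarrow> linear_on s s' V (\<lambda>v. G (F v))"
  by (simp add: linear_on_def)

lemma linear_on_id: "linear_on s s V (\<lambda>v. v)"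
  by (simp add: linear_on_def)

lemma linear_on_diff:
  "linear_on mat_scale mat_scale V F \<Longrightarrow> linear_on mat_scale mat_scale V G \<Longrightarrow>
    linear_on mat_scale mat_scale V (\<lambda>v. F v - G v)"
  by (simp add: linear_on_def mat.scale_right_diff_distrib)

lemma linear_on_mult_left: "linear_on mat_scale mat_scale V F \<Longrightarrow> linear_on mat_scale mat_scale V (\<lambda>v. A ** F v)"
  and linear_on_mult_right: "linear_on mat_scale mat_scale V F \<Longrightarrow> linear_on mat_scale mat_scale V (\<lambda>v. F v ** A)"
  by (simp_all add: linear_on_def mat_mult_add)

lemma linear_on_add_scale:
  "linear_on mat_scale mat_scale V F \<Longrightarrow> linear_on mat_scale mat_scale V G \<Longrightarrow>
    linear_on mat_scale mat_scale V (\<lambda>v. mat_scale a (F v) + mat_scale b (G v))"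
  by (simp add: linear_on_def mat.scale_right_distrib mult.commute)

lemma lin_ops_restrictI:
  "linear_on mat_scale mat_scale V F \<Longrightarrow> mat.subspace V \<Longrightarrow> (\<And>v. v \<in> V \<Longrightarrow> F v \<in> V) \<Longrightarrow>
    (\<lambda>v\<in>V. F v) \<in> lin_ops mat_scale V"
  by (auto simp: lin_ops_iff linear_on_def mat.subspace_add mat.subspace_scale)

section \<open>The baby Fock space\<close>

text \<open>
  The index set of the product \<open>x\<^sub>i x\<^sub>S\<close>, up to sign.
\<close>

definition toggle :: "'a \<Rightarrow> 'a set \<Rightarrow> 'a set" where
  "toggle i S = (if i \<in> S then S - {i} else insert i S)"

lemma x_prod_empty [simp]: "x_prod x {} = mat 1"
  by (simp add: x_prod_def)

lemma x_prod_insert_min: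
  assumes "finite S" "\<forall>s\<in>S. m < s"
  shows "x_prod x (insert m S) = x m ** x_prod x S"
proof -
  have "m \<notin> S" using assms(2) by blast
  moreover have "Min (insert m S) = m"
    using assms by (intro Min_eqI) (auto intro: less_imp_le)
  ultimately show ?thesis
    using assms(1) by (simp add: x_prod_def sorted_list_of_set_nonempty)
qed

lemma finite_pm [simp]: "finite (pm n)"
  by (simp add: pm_def)

lemma sum_pm: "(\<Sum>i\<in>pm n. g i) = (\<Sum>j\<in>{1..n}. g (int j) + g (- int j))"
proof (induction n)
  case 0
  then show ?case by (simp add: pm_def)
next
  case (Suc n)
  have "pm (Suc n) = insert (int (Suc n)) (insert (- int (Suc n)) (pm n))"
    by (auto simp: pm_def)
  moreover have "int (Suc n) \<notin> insert (- int (Suc n)) (pm n)" "- int (Suc n) \<notin> pm n"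
    by (auto simp: pm_def)
  ultimately show ?case using Suc by (simp add: add_ac del: of_nat_Suc)
qed

locale baby_fock =
  fixes n :: nat and \<epsilon> :: "int \<Rightarrow> int \<Rightarrow> int" and x :: "int \<Rightarrow> complex^'m^'m"
  assumes eps: "i \<in> pm n \<Longrightarrow> k \<in> pm n \<Longrightarrow> \<epsilon> i k \<in> {-1, 1} \<and> \<epsilon> i k = \<epsilon> k i \<and> \<epsilon> i k = \<epsilon> \<bar>i\<bar> \<bar>k\<bar>"
    and eps_self: "i \<in> pm n \<Longrightarrow> \<epsilon> i i = -1"
    and x_adj: "i \<in> pm n \<Longrightarrow> mat_adj (x i) = x i"
    and x_rel: "i \<in> pm n \<Longrightarrow> k \<in> pm n \<Longrightarrow>
           x i ** x k - mat_scale (of_int (\<epsilon> i k)) (x k ** x i) = mat_scale (if i = k then 2 else 0) (mat 1)"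
    and x_inj: "inj_on (x_prod x) (Pow (pm n))"
    and x_indep: "mat.independent (x_prod x ` Pow (pm n))"
begin

lemma pm_minus [simp]: "i \<in> pm n \<Longrightarrow> - i \<in> pm n"
  by (auto simp: pm_def)

lemma pm_int [simp]: "j \<in> {1..n} \<Longrightarrow> int j \<in> pm n"
  by (auto simp: pm_def)

lemma pm_neq_minus: "i \<in> pm n \<Longrightarrow> i \<noteq> - i" "i \<in> pm n \<Longrightarrow> - i \<noteq> i"
  by (auto simp: pm_def)

lemma x_square [simp]: "i \<in> pm n \<Longrightarrow> x i ** x i = mat 1"
proof -
  assume i: "i \<in> pm n"
  have "mat_scale 2 (x i ** x i) = mat_scale 2 (mat 1)"
    using x_rel[OF i i] eps_self[OF i] mat.scale_left_distrib[of 1 1 "x i ** x i"] by simp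
  then show ?thesis by simp
qed

lemma x_square_mult [simp]: "i \<in> pm n \<Longrightarrow> x i ** (x i ** h) = h"
  by (simp add: matrix_mul_assoc)

lemma x_comm: "i \<in> pm n \<Longrightarrow> k \<in> pm n \<Longrightarrow> i \<noteq> k \<Longrightarrow> x i ** x k = mat_scale (of_int (\<epsilon> i k)) (x k ** x i)"
  using x_rel[of i k] by simp

lemma x_comm_mult:
  "i \<in> pm n \<Longrightarrow> k \<in> pm n \<Longrightarrow> i \<noteq> k \<Longrightarrow> x i ** (x k ** h) = mat_scale (of_int (\<epsilon> i k)) (x k ** (x i ** h))"
  by (metis mat_scale_mult_left matrix_mul_assoc x_comm)

definition sgn_prod :: "int \<Rightarrow> int set \<Rightarrow> complex" where
  "sgn_prod i S = (\<Prod>s\<in>S. of_int (\<epsilon> i s))"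

lemma sgn_prod_minus: "i \<in> pm n \<Longrightarrow> S \<subseteq> pm n \<Longrightarrow> sgn_prod (- i) S = sgn_prod i S"
  unfolding sgn_prod_def
proof (intro prod.cong refl arg_cong[where f = of_int])
  fix s assume "i \<in> pm n" "S \<subseteq> pm n" "s \<in> S"
  then show "\<epsilon> (- i) s = \<epsilon> i s"
    using eps[of "- i" s] eps[of i s] by (auto simp: subset_iff)
qed

lemma finite_subset_pm: "S \<subseteq> pm n \<Longrightarrow> finite S"
  by (rule finite_subset) auto

lemma toggle_pm [simp]: "i \<in> pm n \<Longrightarrow> S \<subseteq> pm n \<Longrightarrow> toggle i S \<subseteq> pm n"
  by (auto simp: toggle_def)

text \<open>
  Moving \<open>x\<^sub>i\<close> to its place in the increasing product costs one sign per factor passed; if \<open>i\<close> is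
  already present, \<open>x\<^sub>i\<^sup>2 = 1\<close> removes it. The induction peels off the least element of \<open>S\<close>, the
  outermost factor of the product.
\<close>

lemma left_mult_x_prod:
  assumes "S \<subseteq> pm n" "i \<in> pm n"
  shows "\<exists>c\<in>{1, -1}. x i ** x_prod x S = mat_scale c (x_prod x (toggle i S))"
  using finite_subset_pm[OF assms(1)] assms(1)
proof (induction S rule: finite_linorder_min_induct)
  case empty
  then show ?case using x_prod_insert_min[of "{}" i x] by (simp add: toggle_def)
next
  case (insert b A)
  then have b: "b \<in> pm n" and prod: "x_prod x (insert b A) = x b ** x_prod x A"
    by (auto simp: x_prod_insert_min)
  consider "i < b" | "i = b" | "i > b" by linarith
  then show ?case
  proof cases
    case 1
    then have "toggle i (insert b A) = insert i (insert b A)" using insert.hyps by (auto simp: toggle_def)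
    moreover have "x_prod x (insert i (insert b A)) = x i ** x_prod x (insert b A)"
      using 1 insert.hyps by (intro x_prod_insert_min) auto
    ultimately show ?thesis by simp
  next
    case 2
    have "b \<notin> A" using insert.hyps by auto
    then have "toggle i (insert b A) = A" using 2 by (auto simp: toggle_def)
    then show ?thesis using 2 b by (simp add: prod)
  next
    case 3
    then have tog: "toggle i (insert b A) = insert b (toggle i A)" by (auto simp: toggle_def)
    have min: "x_prod x (insert b (toggle i A)) = x b ** x_prod x (toggle i A)"
      using 3 insert.hyps by (intro x_prod_insert_min) (auto simp: toggle_def)
    obtain c where c: "c \<in> {1, -1}" "x i ** x_prod x A = mat_scale c (x_prod x (toggle i A))"
      using insert by blast
    have "x i ** x_prod x (insert b A) = mat_scale (of_int (\<epsilon> i b) * c) (x_prod x (toggle i (insert b A)))"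
      using 3 b assms(2) by (simp add: prod x_comm_mult c tog min)
    moreover have "of_int (\<epsilon> i b) * c \<in> {1, -1}"
    proof -
      have "\<epsilon> i b = 1 \<or> \<epsilon> i b = - 1" using eps[OF assms(2) b] by auto
      then show ?thesis using c(1) by auto
    qed
    ultimately show ?thesis by blast
  qed
qed

text \<open>
  Here the exact sign is needed. Moving \<open>x\<^sub>i\<close> from the right end to the left end passes every factor,
  but passing \<open>x\<^sub>i\<close> itself costs no sign although \<open>\<epsilon>(i,i) = -1\<close>; this is why \<open>i\<close> is removed from \<open>S\<close>.
\<close>

lemma x_prod_mult_right:
  assumes "S \<subseteq> pm n" "i \<in> pm n"
  shows "x_prod x S ** x i = mat_scale (sgn_prod i (S - {i})) (x i ** x_prod x S)"
  using finite_subset_pm[OF assms(1)] assms(1)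
proof (induction S rule: finite_linorder_min_induct)
  case empty
  then show ?case by (simp add: sgn_prod_def)
next
  case (insert b A)
  then have b: "b \<in> pm n" "b \<notin> A" and prod: "x_prod x (insert b A) = x b ** x_prod x A"
    by (auto simp: x_prod_insert_min)
  have IH: "x b ** (x_prod x A ** x i) = mat_scale (sgn_prod i (A - {i})) (x b ** (x i ** x_prod x A))"
    using insert by simp
  show ?case
  proof (cases "b = i")
    case True
    then have "insert b A - {i} = A - {i}" by auto
    then show ?thesis using IH prod True by (simp flip: matrix_mul_assoc)
  next
    case False
    then have ins: "insert b A - {i} = insert b (A - {i})" by auto
    have "sgn_prod i (insert b A - {i}) = of_int (\<epsilon> b i) * sgn_prod i (A - {i})"
      unfolding ins sgn_prod_def using b insert.hyps eps[OF assms(2) b(1)] by simp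
    moreover have "x b ** (x i ** x_prod x A) = mat_scale (of_int (\<epsilon> b i)) (x i ** (x b ** x_prod x A))"
      by (rule x_comm_mult[OF b(1) assms(2) False])
    ultimately show ?thesis
      using IH by (simp add: prod mult.commute flip: matrix_mul_assoc)
  qed
qed

lemma sgn_prod_is_sign:
  assumes "S \<subseteq> pm n" "i \<in> pm n"
  shows "sgn_prod i S \<in> {1, -1}"
  using finite_subset_pm[OF assms(1)] assms(1)
proof (induction S rule: finite_induct)
  case (insert b A)
  then have "\<epsilon> i b = 1 \<or> \<epsilon> i b = - 1" using eps[OF assms(2), of b] by auto
  then show ?case using insert by (auto simp: sgn_prod_def)
qed (simp add: sgn_prod_def)

lemma right_mult_x_prod:
  assumes "S \<subseteq> pm n" "i \<in> pm n"
  shows "\<exists>c\<in>{1, -1}. x_prod x S ** x i = mat_scale c (x_prod x (toggle i S))"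
proof -
  obtain c where "c \<in> {1, -1}" "x i ** x_prod x S = mat_scale c (x_prod x (toggle i S))"
    using left_mult_x_prod[OF assms] by blast
  moreover have "sgn_prod i (S - {i}) \<in> {1, -1}"
    using assms by (intro sgn_prod_is_sign) auto
  ultimately have "sgn_prod i (S - {i}) * c \<in> {1, -1}"
    "x_prod x S ** x i = mat_scale (sgn_prod i (S - {i}) * c) (x_prod x (toggle i S))"
    using x_prod_mult_right[OF assms] by auto
  then show ?thesis by blast
qed

subsection \<open>The inner product\<close>

text \<open>
  Absorbing the factors of \<open>x\<^sub>S\<^sup>*\<close> into \<open>x\<^sub>T\<close> one at a time toggles the elements of \<open>S\<close>, leaving the
  symmetric difference of \<open>S\<close> and \<open>T\<close>. The state vanishes on it unless it is empty, which gives
  orthogonality.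
\<close>

lemma adj_x_prod_mult:
  assumes "S \<subseteq> pm n" "T \<subseteq> pm n"
  shows "\<exists>c. mat_adj (x_prod x S) ** x_prod x T = mat_scale c (x_prod x ((S - T) \<union> (T - S)))"
  using finite_subset_pm[OF assms(1)] assms
proof (induction S arbitrary: T rule: finite_linorder_min_induct)
  case empty
  then show ?case by (auto simp: mat_adj_one intro: exI[of _ 1])
next
  case (insert b A)
  then have b: "b \<in> pm n" "b \<notin> A" and prod: "x_prod x (insert b A) = x b ** x_prod x A"
    by (auto simp: x_prod_insert_min)
  obtain c where c: "x b ** x_prod x T = mat_scale c (x_prod x (toggle b T))"
    using left_mult_x_prod insert.prems(2) b(1) by blast
  obtain d where d: "mat_adj (x_prod x A) ** x_prod x (toggle b T) =
      mat_scale d (x_prod x ((A - toggle b T) \<union> (toggle b T - A)))"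
    using insert b by (metis insert_subset toggle_pm)
  have "(A - toggle b T) \<union> (toggle b T - A) = (insert b A - T) \<union> (T - insert b A)"
    using b(2) by (auto simp: toggle_def)
  then have "mat_adj (x_prod x (insert b A)) ** x_prod x T =
      mat_scale (c * d) (x_prod x ((insert b A - T) \<union> (T - insert b A)))"
    using b d by (simp add: prod mat_adj_mult x_adj c flip: matrix_mul_assoc)
  then show ?case by blast
qed

lemma adj_x_prod_self:
  assumes "S \<subseteq> pm n"
  shows "mat_adj (x_prod x S) ** x_prod x S = mat 1"
  using finite_subset_pm[OF assms] assms
proof (induction S rule: finite_linorder_min_induct)
  case (insert b A)
  then show ?case
    by (simp add: x_prod_insert_min mat_adj_mult x_adj flip: matrix_mul_assoc)
qed (simp add: mat_adj_one)

lemma linear_on_H_state: "linear_on mat_scale (*) (H n x) (H_state n x)"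
  unfolding H_state_def H_def
  by (rule linear_on_lin_ext[OF mat.vector_space_axioms vector_space_over_itself.vector_space_axioms x_indep]) simp

lemma H_state_x_prod: "S \<subseteq> pm n \<Longrightarrow> H_state n x (x_prod x S) = (if S = {} then 1 else 0)"
  unfolding H_state_def
  by (subst lin_ext_basis[OF mat.vector_space_axioms vector_space_over_itself.vector_space_axioms _ x_inj x_indep]) auto

lemma x_prod_in_H [simp]: "S \<subseteq> pm n \<Longrightarrow> x_prod x S \<in> H n x"
  by (auto simp: H_def intro: mat.span_base)

lemma subspace_H: "mat.subspace (H n x)"
  by (simp add: H_def)

lemma H_ip_x_prod:
  assumes "S \<subseteq> pm n" "T \<subseteq> pm n"
  shows "mat_adj (x_prod x S) ** x_prod x T \<in> H n x"
    and "H_ip n x (x_prod x S) (x_prod x T) = (if S = T then 1 else 0)"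
proof -
  obtain c where c: "mat_adj (x_prod x S) ** x_prod x T = mat_scale c (x_prod x ((S - T) \<union> (T - S)))"
    using adj_x_prod_mult[OF assms] by blast
  have U: "(S - T) \<union> (T - S) \<subseteq> pm n" using assms by auto
  then show "mat_adj (x_prod x S) ** x_prod x T \<in> H n x"
    by (simp add: c mat.subspace_scale[OF subspace_H])
  show "H_ip n x (x_prod x S) (x_prod x T) = (if S = T then 1 else 0)"
  proof (cases "S = T")
    case True
    then show ?thesis
      using adj_x_prod_self[OF assms(2)] H_state_x_prod[of "{}"] by (simp add: H_ip_def)
  next
    case False
    then show ?thesis
      using linear_on_scale[OF linear_on_H_state, of "x_prod x ((S - T) \<union> (T - S))" c] U
        H_state_x_prod[OF U] by (auto simp: H_ip_def c)
  qed
qed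

sublocale Hs: onb_space mat_scale "H n x" "H_ip n x" "Pow (pm n)" "x_prod x"
proof unfold_locales
  show "finite (Pow (pm n))" by simp
  show "H n x = mat.span (x_prod x ` Pow (pm n))" by (simp add: H_def)
  fix a b :: "int set \<Rightarrow> complex"
  let ?P = "Pow (pm n)"
  have in_H: "(\<Sum>T\<in>?P. mat_scale (b T) (mat_adj (x_prod x S) ** x_prod x T)) \<in> H n x" if "S \<in> ?P" for S
    using that by (intro mat.subspace_sum[OF subspace_H] mat.subspace_scale[OF subspace_H] H_ip_x_prod(1)) auto
  have "H_ip n x (\<Sum>S\<in>?P. mat_scale (a S) (x_prod x S)) (\<Sum>T\<in>?P. mat_scale (b T) (x_prod x T)) =
      H_state n x (\<Sum>S\<in>?P. mat_scale (cnj (a S)) (\<Sum>T\<in>?P. mat_scale (b T) (mat_adj (x_prod x S) ** x_prod x T)))"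
    unfolding H_ip_def mat_adj_sum mat_mult_sum(1)
    by (simp add: mat_adj_scale mat_mult_sum(2) mat.scale_sum_right mult.commute)
  also have "\<dots> = (\<Sum>S\<in>?P. cnj (a S) * H_state n x (\<Sum>T\<in>?P. mat_scale (b T) (mat_adj (x_prod x S) ** x_prod x T)))"
    by (rule linear_on_sum[OF mat.vector_space_axioms vector_space_over_itself.vector_space_axioms subspace_H linear_on_H_state])
       (use in_H in auto)
  also have "\<dots> = (\<Sum>S\<in>?P. cnj (a S) * (\<Sum>T\<in>?P. b T * H_ip n x (x_prod x S) (x_prod x T)))"
    unfolding H_ip_def
    by (intro sum.cong refl arg_cong[where f = "\<lambda>t. _ * t"]
        linear_on_sum[OF mat.vector_space_axioms vector_space_over_itself.vector_space_axioms subspace_H linear_on_H_state])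
       (auto intro: H_ip_x_prod(1))
  also have "\<dots> = (\<Sum>S\<in>?P. cnj (a S) * b S)"
    by (intro sum.cong refl) (simp add: H_ip_x_prod(2) if_distrib[where f = "\<lambda>t. _ * t"] cong: if_cong)
  finally show "H_ip n x (\<Sum>S\<in>?P. mat_scale (a S) (x_prod x S)) (\<Sum>T\<in>?P. mat_scale (b T) (x_prod x T)) =
      (\<Sum>S\<in>?P. cnj (a S) * b S)" .
qed

lemma one_in_H [simp]: "mat 1 \<in> H n x"
  using x_prod_in_H[of "{}"] by simp

lemma H_eqI:
  assumes "linear_on mat_scale mat_scale (H n x) F" "linear_on mat_scale mat_scale (H n x) G"
    and "\<And>S. S \<subseteq> pm n \<Longrightarrow> F (x_prod x S) = G (x_prod x S)" "h \<in> H n x"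
  shows "F h = G h"
  by (rule Hs.linear_on_eqI[OF mat.vector_space_axioms assms(1,2) _ assms(4)]) (use assms(3) in auto)

lemma H_closed:
  assumes "linear_on mat_scale mat_scale (H n x) F" "\<And>S. S \<subseteq> pm n \<Longrightarrow> F (x_prod x S) \<in> H n x" "h \<in> H n x"
  shows "F h \<in> H n x"
  unfolding Hs.linear_on_expand[OF mat.vector_space_axioms assms(1,3)]
  by (intro Hs.V_sum Hs.V_scale assms(2)) auto

lemma left_in_H [simp]: "i \<in> pm n \<Longrightarrow> h \<in> H n x \<Longrightarrow> x i ** h \<in> H n x"
proof (rule H_closed[where F = "\<lambda>h. x i ** h"])
  fix S assume "i \<in> pm n" "S \<subseteq> pm n"
  then show "x i ** x_prod x S \<in> H n x"
    using left_mult_x_prod[of S i] by (metis Hs.V_scale toggle_pm x_prod_in_H)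
qed (intro linear_on_mult_left linear_on_id)

lemma right_in_H [simp]: "i \<in> pm n \<Longrightarrow> h \<in> H n x \<Longrightarrow> h ** x i \<in> H n x"
proof (rule H_closed[where F = "\<lambda>h. h ** x i"])
  fix S assume "i \<in> pm n" "S \<subseteq> pm n"
  then show "x_prod x S ** x i \<in> H n x"
    using right_mult_x_prod[of S i] by (metis Hs.V_scale toggle_pm x_prod_in_H)
qed (intro linear_on_mult_right linear_on_id)

subsection \<open>Occupation projections\<close>

text \<open>
  The orthogonal projection onto the span of those \<open>x\<^sub>S\<close> in which \<open>i\<close> is occupied. Since \<open>\<beta>\<^sub>i\<close> and
  \<open>\<beta>\<^sub>i\<^sup>*\<close> are \<open>h \<mapsto> x\<^sub>i P\<^sub>i h\<close> and \<open>h \<mapsto> x\<^sub>i (h - P\<^sub>i h)\<close>, all later computations reduce to moving these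
  projections past multiplications.
\<close>

definition P :: "int \<Rightarrow> complex^'m^'m \<Rightarrow> complex^'m^'m" where
  "P i = lin_ext mat_scale mat_scale (Pow (pm n)) (x_prod x) (\<lambda>S. if i \<in> S then x_prod x S else 0)"

lemma linear_on_H_lin_ext:
  "linear_on mat_scale mat_scale (H n x) (lin_ext mat_scale mat_scale (Pow (pm n)) (x_prod x) g)"
  by (rule linear_on_lin_ext[OF mat.vector_space_axioms mat.vector_space_axioms x_indep]) (simp add: H_def)

lemma lin_ext_x_prod:
  "S \<subseteq> pm n \<Longrightarrow> lin_ext mat_scale mat_scale (Pow (pm n)) (x_prod x) g (x_prod x S) = g S"
  by (rule lin_ext_basis[OF mat.vector_space_axioms mat.vector_space_axioms _ x_inj x_indep]) auto

lemma P_linear: "linear_on mat_scale mat_scale (H n x) (P i)"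
  unfolding P_def by (rule linear_on_H_lin_ext)

lemma P_x_prod: "S \<subseteq> pm n \<Longrightarrow> P i (x_prod x S) = (if i \<in> S then x_prod x S else 0)"
  unfolding P_def by (simp add: lin_ext_x_prod)

lemma P_in_H [simp]: "h \<in> H n x \<Longrightarrow> P i h \<in> H n x"
  by (rule H_closed[OF P_linear]) (auto simp: P_x_prod)

lemma P_add [simp]: "g \<in> H n x \<Longrightarrow> h \<in> H n x \<Longrightarrow> P i (g + h) = P i g + P i h"
  and P_scale [simp]: "h \<in> H n x \<Longrightarrow> P i (mat_scale c h) = mat_scale c (P i h)"
  using P_linear by (auto simp: linear_on_def)

lemma P_zero [simp]: "P i 0 = 0"
  using P_scale[of 0 i 0] by simp

lemma P_diff [simp]: "g \<in> H n x \<Longrightarrow> h \<in> H n x \<Longrightarrow> P i (g - h) = P i g - P i h"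
  using P_add[of "g - h" h i] by (simp add: algebra_simps)

lemmas linear_intros = linear_on_diff linear_on_mult_left linear_on_mult_right linear_on_id P_linear
  linear_on_compose[OF _ P_linear]

lemma P_P [simp]: "h \<in> H n x \<Longrightarrow> P i (P i h) = P i h"
  by (rule H_eqI[where F = "\<lambda>h. P i (P i h)" and G = "P i"])
     (auto intro!: linear_intros simp: P_x_prod)

text \<open>
  Multiplication by \<open>x\<^sub>i\<close> reverses the occupation of \<open>i\<close> and leaves that of every other index
  alone.
\<close>

lemma P_left:
  assumes "i \<in> pm n" "h \<in> H n x"
  shows P_left_same: "P i (x i ** h) = x i ** h - x i ** P i h"
    and P_left_other: "k \<noteq> i \<Longrightarrow> P k (x i ** h) = x i ** P k h"
proof -
  have *: "P k (x i ** x_prod x S) = (if k = i \<longleftrightarrow> k \<in> S then 0 else x i ** x_prod x S)" if S: "S \<subseteq> pm n" for S k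
  proof -
    obtain c where "x i ** x_prod x S = mat_scale c (x_prod x (toggle i S))"
      using left_mult_x_prod[OF S assms(1)] by blast
    then show ?thesis
      using S P_x_prod[OF toggle_pm[OF assms(1) S], of k]
        P_scale[OF x_prod_in_H[OF toggle_pm[OF assms(1) S]], of k c] by (auto simp: toggle_def split: if_splits)
  qed
  show "P i (x i ** h) = x i ** h - x i ** P i h"
    by (rule H_eqI[OF _ _ _ assms(2), where F = "\<lambda>h. P i (x i ** h)" and G = "\<lambda>h. x i ** h - x i ** P i h"])
       (use assms(1) in \<open>auto intro!: linear_intros simp: * P_x_prod\<close>)
  show "P k (x i ** h) = x i ** P k h" if "k \<noteq> i"
    by (rule H_eqI[OF _ _ _ assms(2), where F = "\<lambda>h. P k (x i ** h)" and G = "\<lambda>h. x i ** P k h"])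
       (use assms(1) that in \<open>auto intro!: linear_intros simp: * P_x_prod\<close>)
qed

lemma P_right:
  assumes "i \<in> pm n" "h \<in> H n x"
  shows P_right_same: "P i (h ** x i) = h ** x i - P i h ** x i"
    and P_right_other: "k \<noteq> i \<Longrightarrow> P k (h ** x i) = P k h ** x i"
proof -
  have *: "P k (x_prod x S ** x i) = (if k = i \<longleftrightarrow> k \<in> S then 0 else x_prod x S ** x i)" if S: "S \<subseteq> pm n" for S k
  proof -
    obtain c where "x_prod x S ** x i = mat_scale c (x_prod x (toggle i S))"
      using right_mult_x_prod[OF S assms(1)] by blast
    then show ?thesis
      using S P_x_prod[OF toggle_pm[OF assms(1) S], of k]
        P_scale[OF x_prod_in_H[OF toggle_pm[OF assms(1) S]], of k c] by (auto simp: toggle_def split: if_splits)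
  qed
  show "P i (h ** x i) = h ** x i - P i h ** x i"
    by (rule H_eqI[OF _ _ _ assms(2), where F = "\<lambda>h. P i (h ** x i)" and G = "\<lambda>h. h ** x i - P i h ** x i"])
       (use assms(1) in \<open>auto intro!: linear_intros simp: * P_x_prod\<close>)
  show "P k (h ** x i) = P k h ** x i" if "k \<noteq> i"
    by (rule H_eqI[OF _ _ _ assms(2), where F = "\<lambda>h. P k (h ** x i)" and G = "\<lambda>h. P k h ** x i"])
       (use assms(1) that in \<open>auto intro!: linear_intros simp: * P_x_prod\<close>)
qed

lemma lin_ops_eq_adjI:
  assumes "linear_on mat_scale mat_scale (H n x) F" "\<And>h. h \<in> H n x \<Longrightarrow> F h \<in> H n x"
    and "\<And>S T. S \<subseteq> pm n \<Longrightarrow> T \<subseteq> pm n \<Longrightarrow> H_ip n x (F (x_prod x S)) (x_prod x T) = H_ip n x (x_prod x S) (F (x_prod x T))"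
    and "g \<in> H n x" "h \<in> H n x"
  shows "H_ip n x (F g) h = H_ip n x g (F h)"
proof -
  define F' where "F' = (\<lambda>h\<in>H n x. F h)"
  have F': "F' \<in> lin_ops mat_scale (H n x)"
    unfolding F'_def by (rule lin_ops_restrictI[OF assms(1) subspace_H assms(2)])
  have "H_adj n x F' = F'"
    by (rule Hs.adj_eq_on_basisI[OF F' F']) (auto simp: F'_def assms(3))
  then show ?thesis
    using Hs.ip_adj[OF F' assms(4,5)] assms(4,5) by (simp add: F'_def)
qed

lemma ip_P:
  assumes "g \<in> H n x" "h \<in> H n x"
  shows "H_ip n x (P i g) h = H_ip n x g (P i h)"
proof (rule lin_ops_eq_adjI[OF P_linear P_in_H _ assms])
  have "H_ip n x 0 h = 0" "H_ip n x h 0 = 0" if "h \<in> H n x" for h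
    using Hs.ip_scale_left[OF that that, of 0] Hs.ip_scale_right[OF that that, of 0] by auto
  then show "H_ip n x (P i (x_prod x S)) (x_prod x T) = H_ip n x (x_prod x S) (P i (x_prod x T))"
    if "S \<subseteq> pm n" "T \<subseteq> pm n" for S T
    using that by (auto simp: P_x_prod H_ip_x_prod(2))
qed

lemma ip_left: "i \<in> pm n \<Longrightarrow> H_ip n x (x i ** g) h = H_ip n x g (x i ** h)"
  by (simp add: H_ip_def mat_adj_mult x_adj matrix_mul_assoc)

text \<open>
  Right multiplication by \<open>x\<^sub>i\<close> differs from left multiplication on \<open>x\<^sub>S\<close> by a sign that depends on
  \<open>S - {i}\<close> alone. A matrix entry of left multiplication between \<open>x\<^sub>S\<close> and \<open>x\<^sub>T\<close> is nonzero only if \<open>S\<close> and \<open>T\<close>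
  agree away from \<open>i\<close>, and then the signs for \<open>S\<close> and \<open>T\<close> coincide.
\<close>

lemma ip_right:
  assumes i: "i \<in> pm n" and "g \<in> H n x" "h \<in> H n x"
  shows "H_ip n x (g ** x i) h = H_ip n x g (h ** x i)"
proof (rule lin_ops_eq_adjI[where F = "\<lambda>h. h ** x i", OF _ _ _ assms(2,3)])
  show "linear_on mat_scale mat_scale (H n x) (\<lambda>h. h ** x i)" by (intro linear_intros)
  show "h ** x i \<in> H n x" if "h \<in> H n x" for h using that i by simp
  fix S T assume ST: "S \<subseteq> pm n" "T \<subseteq> pm n"
  obtain c where c: "x i ** x_prod x T = mat_scale c (x_prod x (toggle i T))"
    using left_mult_x_prod[OF ST(2) i] by blast
  have real: "cnj (sgn_prod i U) = sgn_prod i U" for U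
    by (simp add: sgn_prod_def)
  have 1: "H_ip n x (x_prod x S ** x i) (x_prod x T) = sgn_prod i (S - {i}) * H_ip n x (x_prod x S) (x i ** x_prod x T)"
    using ST i by (simp add: x_prod_mult_right Hs.ip_scale_left real ip_left)
  have 2: "H_ip n x (x_prod x S) (x_prod x T ** x i) = sgn_prod i (T - {i}) * H_ip n x (x_prod x S) (x i ** x_prod x T)"
    using ST i by (simp add: x_prod_mult_right Hs.ip_scale_right)
  have 3: "H_ip n x (x_prod x S) (x i ** x_prod x T) = 0" if "S \<noteq> toggle i T"
    using that ST i by (simp add: c Hs.ip_scale_right H_ip_x_prod(2))
  have 4: "S - {i} = T - {i}" if "S = toggle i T"
    using that by (auto simp: toggle_def split: if_splits)
  show "H_ip n x (x_prod x S ** x i) (x_prod x T) = H_ip n x (x_prod x S) (x_prod x T ** x i)"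
    using 1 2 3 4 by (cases "S = toggle i T") auto
qed

text \<open>
  The operator \<open>h \<mapsto> x\<^sub>i (1 - 2 P\<^sub>i)(h) x\<^sub>i\<close>: the failure of left and right ladder operators with the
  same index to commute.
\<close>

definition theta :: "int \<Rightarrow> complex^'m^'m \<Rightarrow> complex^'m^'m" where
  "theta i h = x i ** (h - P i h) ** x i - x i ** P i h ** x i"

text \<open>
  Conjugation by \<open>x\<^sub>i\<close> multiplies \<open>x\<^sub>S\<close> by the product of \<open>\<epsilon>(i,s)\<close> over \<open>s \<in> S - {i}\<close>, and the factor
  \<open>1 - 2 P\<^sub>i\<close> supplies the missing \<open>\<epsilon>(i,i) = -1\<close> when \<open>i \<in> S\<close>. So \<open>x\<^sub>S\<close> is an eigenvector for the
  product over all of \<open>S\<close>, which is the same for \<open>i\<close> and \<open>-i\<close> as \<open>\<epsilon>\<close> depends on absolute values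
  only.
\<close>

lemma theta_minus:
  assumes "i \<in> pm n" "h \<in> H n x"
  shows "theta (- i) h = theta i h"
proof -
  have th: "theta k (x_prod x S) = mat_scale (sgn_prod k S) (x_prod x S)" if k: "k \<in> pm n" and S: "S \<subseteq> pm n" for k S
  proof -
    have conj: "x k ** (x_prod x S ** x k) = mat_scale (sgn_prod k (S - {k})) (x_prod x S)"
      using k S by (simp add: x_prod_mult_right)
    show ?thesis
    proof (cases "k \<in> S")
      case True
      then have "sgn_prod k S = - sgn_prod k (S - {k})"
        using prod.remove[OF finite_subset_pm[OF S] True, of "\<lambda>s. complex_of_int (\<epsilon> k s)"] eps_self[OF k]
        by (simp add: sgn_prod_def)
      then show ?thesis
        using True conj S by (simp add: theta_def P_x_prod mat_mult_diff flip: matrix_mul_assoc)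
    next
      case False
      then show ?thesis
        using conj S by (simp add: theta_def P_x_prod flip: matrix_mul_assoc)
    qed
  qed
  have lin: "linear_on mat_scale mat_scale (H n x) (theta k)" for k
    unfolding theta_def by (intro linear_intros)
  show ?thesis
    by (rule H_eqI[OF lin lin _ assms(2)]) (use assms(1) in \<open>simp add: th sgn_prod_minus\<close>)
qed

end

context baby_fock
begin

section \<open>Left and right annihilation and creation operators\<close>

lemma eps_minus: "i \<in> pm n \<Longrightarrow> k \<in> pm n \<Longrightarrow> \<epsilon> (- i) k = \<epsilon> i k"
  by (metis abs_minus_cancel eps pm_minus)

lemma eps_minus_self: "i \<in> pm n \<Longrightarrow> \<epsilon> i (- i) = - 1"
  by (metis eps eps_minus eps_self pm_minus)

lemma P_P_comm: "h \<in> H n x \<Longrightarrow> P i (P k h) = P k (P i h)"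
  by (rule H_eqI[where F = "\<lambda>h. P i (P k h)" and G = "\<lambda>h. P k (P i h)"])
     (auto intro!: linear_intros simp: P_x_prod)

lemma P_one [simp]: "P i (mat 1) = 0"
  using P_x_prod[of "{}" i] by simp

lemma beta_eq: "h \<in> H n x \<Longrightarrow> beta n x i h = x i ** P i h"
  unfolding beta_def
  by simp (rule H_eqI[where G = "\<lambda>h. x i ** P i h"], auto intro!: linear_intros linear_on_H_lin_ext simp: P_x_prod lin_ext_x_prod)

lemma beta_star_eq: "h \<in> H n x \<Longrightarrow> beta_star n x i h = x i ** (h - P i h)"
  unfolding beta_star_def
  by simp (rule H_eqI[where G = "\<lambda>h. x i ** (h - P i h)"], auto intro!: linear_intros linear_on_H_lin_ext simp: P_x_prod lin_ext_x_prod)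

definition rbeta :: "int \<Rightarrow> complex^'m^'m \<Rightarrow> complex^'m^'m" where
  "rbeta i = (\<lambda>h\<in>H n x. P i h ** x i)"

definition rbeta_star :: "int \<Rightarrow> complex^'m^'m \<Rightarrow> complex^'m^'m" where
  "rbeta_star i = (\<lambda>h\<in>H n x. (h - P i h) ** x i)"

lemma rbeta_eq: "h \<in> H n x \<Longrightarrow> rbeta i h = P i h ** x i"
  and rbeta_star_eq: "h \<in> H n x \<Longrightarrow> rbeta_star i h = (h - P i h) ** x i"
  by (simp_all add: rbeta_def rbeta_star_def)

lemmas ladder_eq = beta_eq beta_star_eq rbeta_eq rbeta_star_eq

lemma ladder_lin_ops:
  assumes "i \<in> pm n"
  shows "beta n x i \<in> lin_ops mat_scale (H n x)" "beta_star n x i \<in> lin_ops mat_scale (H n x)"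
    and "rbeta i \<in> lin_ops mat_scale (H n x)" "rbeta_star i \<in> lin_ops mat_scale (H n x)"
proof -
  have "beta n x i = (\<lambda>h\<in>H n x. x i ** P i h)" "beta_star n x i = (\<lambda>h\<in>H n x. x i ** (h - P i h))"
    using beta_eq beta_star_eq by (auto simp: fun_eq_iff beta_def beta_star_def)
  then show "beta n x i \<in> lin_ops mat_scale (H n x)" "beta_star n x i \<in> lin_ops mat_scale (H n x)"
    "rbeta i \<in> lin_ops mat_scale (H n x)" "rbeta_star i \<in> lin_ops mat_scale (H n x)"
    using assms by (auto simp: rbeta_def rbeta_star_def intro!: lin_ops_restrictI subspace_H linear_intros)
qed

lemmas ladder_in_H [simp] = ladder_lin_ops[THEN lin_ops_in]

lemma ip_beta:
  assumes "i \<in> pm n" "g \<in> H n x" "h \<in> H n x"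
  shows "H_ip n x (beta n x i g) h = H_ip n x g (beta_star n x i h)"
    and "H_ip n x (beta_star n x i g) h = H_ip n x g (beta n x i h)"
proof -
  have *: "H_ip n x (beta n x i g) h = H_ip n x g (beta_star n x i h)" if "g \<in> H n x" "h \<in> H n x" for g h
    using assms(1) that by (simp add: ladder_eq ip_left ip_P P_left_same mat_mult_diff)
  show "H_ip n x (beta n x i g) h = H_ip n x g (beta_star n x i h)"
    by (rule *[OF assms(2,3)])
  show "H_ip n x (beta_star n x i g) h = H_ip n x g (beta n x i h)"
    using *[OF assms(3,2)] assms Hs.ip_cnj[of "beta_star n x i g" h] Hs.ip_cnj[of g "beta n x i h"] by simp
qed

lemma ip_rbeta:
  assumes "i \<in> pm n" "g \<in> H n x" "h \<in> H n x"
  shows "H_ip n x (rbeta i g) h = H_ip n x g (rbeta_star i h)"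
    and "H_ip n x (rbeta_star i g) h = H_ip n x g (rbeta i h)"
proof -
  have *: "H_ip n x (rbeta i g) h = H_ip n x g (rbeta_star i h)" if "g \<in> H n x" "h \<in> H n x" for g h
    using assms(1) that by (simp add: ladder_eq ip_right ip_P P_right_same mat_mult_diff)
  show "H_ip n x (rbeta i g) h = H_ip n x g (rbeta_star i h)"
    by (rule *[OF assms(2,3)])
  show "H_ip n x (rbeta_star i g) h = H_ip n x g (rbeta i h)"
    using *[OF assms(3,2)] assms Hs.ip_cnj[of "rbeta_star i g" h] Hs.ip_cnj[of g "rbeta i h"] by simp
qed

text \<open>
  Left and right multiplications commute, and changing the occupation of \<open>k\<close> does not affect that
  of \<open>i\<close>.
\<close>

lemma ladder_commute_other:
  assumes "i \<in> pm n" "k \<in> pm n" "i \<noteq> k" "h \<in> H n x"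
  shows "beta n x i (rbeta k h) = rbeta k (beta n x i h)"
    and "beta n x i (rbeta_star k h) = rbeta_star k (beta n x i h)"
    and "beta_star n x i (rbeta k h) = rbeta k (beta_star n x i h)"
    and "beta_star n x i (rbeta_star k h) = rbeta_star k (beta_star n x i h)"
  using assms
  by (simp_all add: ladder_eq P_left_other P_right_other P_P_comm[of h i k] mat_mult_diff flip: matrix_mul_assoc)

text \<open>
  Two annihilations, or two creations, at the same index give \<open>0\<close> in either order. An annihilation and
  a creation see different occupations in the two orders, and their commutator is \<open>\<theta>\<^sub>i\<close> up to
  sign.
\<close>

lemma ladder_commute_same:
  assumes "i \<in> pm n" "h \<in> H n x"
  shows "beta n x i (rbeta i h) = rbeta i (beta n x i h)"
    and "beta_star n x i (rbeta_star i h) = rbeta_star i (beta_star n x i h)"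
    and "beta n x i (rbeta_star i h) = rbeta_star i (beta n x i h) + theta i h"
    and "beta_star n x i (rbeta i h) = rbeta i (beta_star n x i h) - theta i h"
  using assms
  by (simp_all add: ladder_eq P_left_same P_right_same theta_def mat_mult_diff flip: matrix_mul_assoc)

definition lin_comb where
  "lin_comb a A b B = (\<lambda>h\<in>H n x. mat_scale (complex_of_real a) (A h) + mat_scale (complex_of_real b) (B h))"

lemma lin_comb_lin_ops:
  assumes "A \<in> lin_ops mat_scale (H n x)" "B \<in> lin_ops mat_scale (H n x)"
  shows "lin_comb a A b B \<in> lin_ops mat_scale (H n x)"
  unfolding lin_comb_def
  by (intro lin_ops_restrictI linear_on_add_scale lin_ops_linear assms subspace_H Hs.V_add Hs.V_scale
      lin_ops_in[OF assms(1)] lin_ops_in[OF assms(2)])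

lemma adj_comb:
  assumes "A \<in> lin_ops mat_scale (H n x)" "B \<in> lin_ops mat_scale (H n x)"
    and "A' \<in> lin_ops mat_scale (H n x)" "B' \<in> lin_ops mat_scale (H n x)"
    and "\<And>g h. g \<in> H n x \<Longrightarrow> h \<in> H n x \<Longrightarrow> H_ip n x (A g) h = H_ip n x g (A' h)"
    and "\<And>g h. g \<in> H n x \<Longrightarrow> h \<in> H n x \<Longrightarrow> H_ip n x (B g) h = H_ip n x g (B' h)"
  shows "H_adj n x (lin_comb a A b B) = lin_comb a A' b B'"
proof (rule Hs.adj_eqI)
  show "lin_comb a A' b B' \<in> lin_ops mat_scale (H n x)" by (intro lin_comb_lin_ops assms)
  show "lin_comb a A b B h \<in> H n x" if "h \<in> H n x" for h
    by (intro lin_ops_in[OF lin_comb_lin_ops] assms that)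
  show "H_ip n x (lin_comb a A b B g) h = H_ip n x g (lin_comb a A' b B' h)" if "g \<in> H n x" "h \<in> H n x" for g h
    using that assms(5,6)
    by (simp add: lin_comb_def Hs.ip_add_left Hs.ip_add_right Hs.ip_scale_left Hs.ip_scale_right
        lin_ops_in[OF assms(1)] lin_ops_in[OF assms(2)] lin_ops_in[OF assms(3)] lin_ops_in[OF assms(4)])
qed

lemma lin_comb_comb:
  assumes "A \<in> lin_ops mat_scale (H n x)" "B \<in> lin_ops mat_scale (H n x)"
    and "C \<in> lin_ops mat_scale (H n x)" "D \<in> lin_ops mat_scale (H n x)" "h \<in> H n x"
  shows "lin_comb a A b B (lin_comb c C d D h) =
    mat_scale (complex_of_real (a * c)) (A (C h)) + mat_scale (complex_of_real (a * d)) (A (D h)) +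
    (mat_scale (complex_of_real (b * c)) (B (C h)) + mat_scale (complex_of_real (b * d)) (B (D h)))"
  using assms(5) lin_ops_in[OF assms(1)] lin_ops_in[OF assms(2)] lin_ops_in[OF assms(3)] lin_ops_in[OF assms(4)]
    lin_ops_linear[OF assms(1)] lin_ops_linear[OF assms(2)]
  by (simp add: lin_comb_def linear_on_add[of _ _ "H n x" A] linear_on_scale[of _ _ "H n x" A]
      linear_on_add[of _ _ "H n x" B] linear_on_scale[of _ _ "H n x" B] mat.scale_right_distrib)

end

section \<open>The commutant and the vacuum\<close>

locale fock_cube = hypercube n \<mu> + baby_fock n \<epsilon> x
  for n :: nat and \<mu> :: "nat \<Rightarrow> real" and \<epsilon> :: "int \<Rightarrow> int \<Rightarrow> int" and x :: "int \<Rightarrow> complex^'m^'m"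
begin

definition gamma_adj where
  "gamma_adj j = lin_comb (\<mu> j) (beta_star n x (- int j)) (inverse (\<mu> j)) (beta n x (int j))"

text \<open>
  The mirror image of \<open>\<gamma>\<^sub>j\<close>, with the weights \<open>\<mu>\<^sub>j\<close> and \<open>\<mu>\<^sub>j\<^sup>-\<^sup>1\<close> exchanged. The exchange is
  what makes its adjoint commute with \<open>\<gamma>\<^sub>j\<close>.
\<close>

definition right_gamma where
  "right_gamma j = lin_comb (inverse (\<mu> j)) (rbeta (- int j)) (\<mu> j) (rbeta_star (int j))"

definition right_gamma_adj where
  "right_gamma_adj j = lin_comb (inverse (\<mu> j)) (rbeta_star (- int j)) (\<mu> j) (rbeta (int j))"

definition right_ops where
  "right_ops = right_gamma ` {1..n} \<union> right_gamma_adj ` {1..n}"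

lemma gamma_comb: "gamma n \<mu> x j = lin_comb (\<mu> j) (beta n x (- int j)) (inverse (\<mu> j)) (beta_star n x (int j))"
  by (simp add: gamma_def lin_comb_def)

lemma gamma_lin: "j \<in> {1..n} \<Longrightarrow> gamma n \<mu> x j \<in> lin_ops mat_scale (H n x)"
  and right_gamma_lin: "j \<in> {1..n} \<Longrightarrow> right_gamma j \<in> lin_ops mat_scale (H n x)"
  and right_gamma_adj_lin: "j \<in> {1..n} \<Longrightarrow> right_gamma_adj j \<in> lin_ops mat_scale (H n x)"
  unfolding gamma_comb gamma_adj_def right_gamma_def right_gamma_adj_def
  by (intro lin_comb_lin_ops ladder_lin_ops pm_minus pm_int; assumption)+

lemma H_adj_gamma: "j \<in> {1..n} \<Longrightarrow> H_adj n x (gamma n \<mu> x j) = gamma_adj j"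
  unfolding gamma_comb gamma_adj_def
  by (intro adj_comb ladder_lin_ops ip_beta pm_minus pm_int; assumption)

lemma H_adj_right_gamma: "j \<in> {1..n} \<Longrightarrow> H_adj n x (right_gamma j) = right_gamma_adj j"
  and H_adj_right_gamma_adj: "j \<in> {1..n} \<Longrightarrow> H_adj n x (right_gamma_adj j) = right_gamma j"
  unfolding right_gamma_def right_gamma_adj_def
  by (intro adj_comb ladder_lin_ops ip_rbeta pm_minus pm_int; assumption)+

lemma gamma_right_gamma_commute:
  assumes "j \<in> {1..n}" "k \<in> {1..n}" "h \<in> H n x"
  shows "gamma n \<mu> x j (right_gamma k h) = right_gamma k (gamma n \<mu> x j h)"
proof -
  have pm: "int j \<in> pm n" "- int j \<in> pm n" "int k \<in> pm n" "- int k \<in> pm n" using assms by simp_all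
  note lin = ladder_lin_ops
  have ne: "int j \<noteq> - int k" "- int j \<noteq> int k" using assms by auto
  have "beta n x (- int j) (rbeta (- int k) h) = rbeta (- int k) (beta n x (- int j) h)"
    by (cases "j = k") (use pm assms in \<open>simp_all add: ladder_commute_same ladder_commute_other\<close>)
  moreover have "beta_star n x (int j) (rbeta_star (int k) h) = rbeta_star (int k) (beta_star n x (int j) h)"
    by (cases "j = k") (use pm assms in \<open>simp_all add: ladder_commute_same ladder_commute_other\<close>)
  ultimately show ?thesis
    unfolding gamma_comb right_gamma_def
    using pm assms ne by (simp add: lin_comb_comb lin ladder_commute_other mult.commute add_ac)
qed

text \<open>
  Only \<open>k = j\<close> is delicate. There the two commutators of ladder operators enter with coefficients
  \<open>\<mu>\<^sub>j \<mu>\<^sub>j\<^sup>-\<^sup>1 = 1\<close> and \<open>\<mu>\<^sub>j\<^sup>-\<^sup>1 \<mu>\<^sub>j = 1\<close> and contribute \<open>\<theta>\<^bsub>-j\<^esub> - \<theta>\<^sub>j = 0\<close>.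
\<close>

lemma gamma_right_gamma_adj_commute:
  assumes "j \<in> {1..n}" "k \<in> {1..n}" "h \<in> H n x"
  shows "gamma n \<mu> x j (right_gamma_adj k h) = right_gamma_adj k (gamma n \<mu> x j h)"
proof -
  have pm: "int j \<in> pm n" "- int j \<in> pm n" "int k \<in> pm n" "- int k \<in> pm n" using assms by simp_all
  note lin = ladder_lin_ops
  have ne: "int j \<noteq> - int k" "- int j \<noteq> int k" using assms by auto
  have mu: "\<mu> j * inverse (\<mu> j) = 1" "inverse (\<mu> j) * \<mu> j = 1" using \<mu>_pos[OF assms(1)] by auto
  show ?thesis
  proof (cases "j = k")
    case True
    then show ?thesis
      unfolding gamma_comb right_gamma_adj_def
      using pm assms ne mu
      by (simp add: lin_comb_comb lin ladder_commute_other ladder_commute_same theta_minus mult.commute add_ac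
          del: of_real_mult)
  next
    case False
    then show ?thesis
      unfolding gamma_comb right_gamma_adj_def
      using pm assms ne by (simp add: lin_comb_comb lin ladder_commute_other mult.commute add_ac)
  qed
qed

lemma right_ops_lin: "right_ops \<subseteq> lin_ops mat_scale (H n x)"
  using right_gamma_lin right_gamma_adj_lin by (auto simp: right_ops_def)

lemma Gamma_subset_commutant: "Gamma n \<mu> x \<subseteq> commutant mat_scale (H n x) right_ops"
  unfolding Gamma_def
proof (rule Hs.vN_generated_subset)
  show "von_neumann_algebra mat_scale (H n x) (H_ip n x) (commutant mat_scale (H n x) right_ops)"
    by (rule Hs.von_neumann_algebra_commutant[OF right_ops_lin])
       (auto simp: right_ops_def H_adj_right_gamma H_adj_right_gamma_adj simp del: atLeastAtMost_iff)
  show "gamma n \<mu> x ` {1..n} \<subseteq> commutant mat_scale (H n x) right_ops"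
    by (auto simp: Hs.commutant_iff right_ops_def gamma_lin gamma_right_gamma_commute gamma_right_gamma_adj_commute
        simp del: atLeastAtMost_iff)
qed

text \<open>
  Every index \<open>m\<close> is created on the right by some operator of \<open>right_ops\<close>: by \<open>right_gamma\<close> for \<open>m > 0\<close>
  and by its adjoint for \<open>m < 0\<close>. The same operator may also annihilate \<open>-m\<close>.
\<close>

lemma right_op_creating:
  assumes "m \<in> pm n"
  obtains T a b where "T \<in> right_ops" "a \<noteq> 0"
    "\<And>h. h \<in> H n x \<Longrightarrow> T h = mat_scale a (rbeta_star m h) + mat_scale b (rbeta (- m) h)"
proof (cases "m > 0")
  case True
  then have m: "nat m \<in> {1..n}" "int (nat m) = m" using assms by (auto simp: pm_def)
  show ?thesis
  proof (rule that)
    show "right_gamma (nat m) \<in> right_ops" using m by (auto simp: right_ops_def)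
    show "complex_of_real (\<mu> (nat m)) \<noteq> 0" using \<mu>_pos[OF m(1)] by simp
    show "right_gamma (nat m) h = mat_scale (complex_of_real (\<mu> (nat m))) (rbeta_star m h) +
        mat_scale (complex_of_real (inverse (\<mu> (nat m)))) (rbeta (- m) h)" if "h \<in> H n x" for h
      using that m(2) by (simp add: right_gamma_def lin_comb_def)
  qed
next
  case False
  then have m: "nat (- m) \<in> {1..n}" "int (nat (- m)) = - m" using assms by (auto simp: pm_def)
  show ?thesis
  proof (rule that)
    show "right_gamma_adj (nat (- m)) \<in> right_ops" using m by (auto simp: right_ops_def)
    show "complex_of_real (inverse (\<mu> (nat (- m)))) \<noteq> 0" using \<mu>_pos[OF m(1)] by simp
    show "right_gamma_adj (nat (- m)) h = mat_scale (complex_of_real (inverse (\<mu> (nat (- m))))) (rbeta_star m h) +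
        mat_scale (complex_of_real (\<mu> (nat (- m)))) (rbeta (- m) h)" if "h \<in> H n x" for h
      using that m(2) by (simp add: right_gamma_adj_def lin_comb_def)
  qed
qed

text \<open>
  The right operators carry agreement of \<open>X\<close> and \<open>Y\<close> from the vacuum to all \<open>x\<^sub>S\<close>, by induction on the
  size of \<open>S\<close>: for \<open>m \<in> S\<close> and \<open>U = S - {m}\<close>, an operator creating \<open>m\<close> maps \<open>x\<^sub>U\<close> to a nonzero multiple
  of \<open>x\<^sub>S\<close> plus a multiple of a basis vector with fewer than \<open>|U|\<close> factors.
\<close>

lemma vacuum_separating:
  assumes X: "X \<in> commutant mat_scale (H n x) right_ops" and Y: "Y \<in> commutant mat_scale (H n x) right_ops"
    and eq: "X (mat 1) = Y (mat 1)"
  shows "X = Y"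
proof (rule lin_ops_eqI)
  show XY: "X \<in> lin_ops mat_scale (H n x)" "Y \<in> lin_ops mat_scale (H n x)"
    using X Y by (auto simp: Hs.commutant_iff)
  note lin = lin_ops_linear[OF XY(1)] lin_ops_linear[OF XY(2)]
  have basis: "X (x_prod x S) = Y (x_prod x S)" if "S \<subseteq> pm n" for S
    using that
  proof (induction "card S" arbitrary: S rule: less_induct)
    case less
    show ?case
    proof (cases "S = {}")
      case True
      then show ?thesis using eq by simp
    next
      case False
      then obtain m where m: "m \<in> S" "m \<in> pm n" using less.prems by auto
      define U where "U = S - {m}"
      have U: "U \<subseteq> pm n" "m \<notin> U" "toggle m U = S" "card U < card S"
        using less.prems m card_Diff1_less[OF finite_subset_pm[OF less.prems] m(1)] by (auto simp: U_def toggle_def)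
      obtain T a b where T: "T \<in> right_ops" "a \<noteq> 0"
        "\<And>h. h \<in> H n x \<Longrightarrow> T h = mat_scale a (rbeta_star m h) + mat_scale b (rbeta (- m) h)"
        using right_op_creating[OF m(2)] by metis
      let ?u = "x_prod x U"
      have u: "?u \<in> H n x" using U by simp
      have "X (T ?u) = Y (T ?u)"
        using X Y T(1) u less.hyps[OF U(4) U(1)] by (simp add: Hs.commutant_iff)
      moreover have "X (rbeta (- m) ?u) = Y (rbeta (- m) ?u)"
      proof (cases "- m \<in> U")
        case True
        obtain c where c: "?u ** x (- m) = mat_scale c (x_prod x (toggle (- m) U))"
          using right_mult_x_prod[OF U(1) pm_minus[OF m(2)]] by blast
        \<comment> \<open>Removing \<open>-m\<close> leaves fewer elements than \<open>S\<close> has, so the induction hypothesis applies.\<close>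
        have W: "toggle (- m) U \<subseteq> pm n" "card (toggle (- m) U) < card S"
          using True U m finite_subset_pm[OF U(1)] card_Diff1_less[of U "- m"] by (auto simp: toggle_def)
        then show ?thesis
          using less.hyps[OF W(2,1)] True U(1) u
          by (simp add: rbeta_eq P_x_prod c linear_on_scale[OF lin(1)] linear_on_scale[OF lin(2)])
      next
        case False
        then show ?thesis
          using U(1) u linear_on_scale[OF lin(1), of 0 0] linear_on_scale[OF lin(2), of 0 0]
          by (simp add: rbeta_eq P_x_prod)
      qed
      ultimately have "mat_scale a (X (rbeta_star m ?u)) = mat_scale a (Y (rbeta_star m ?u))"
        using u m(2) by (simp add: T(3) linear_on_add[OF lin(1)] linear_on_add[OF lin(2)]
            linear_on_scale[OF lin(1)] linear_on_scale[OF lin(2)])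
      then have "X (?u ** x m) = Y (?u ** x m)"
        using T(2) U u by (simp add: rbeta_star_eq P_x_prod)
      moreover obtain c where c: "c \<in> {1, -1}" "?u ** x m = mat_scale c (x_prod x S)"
        using right_mult_x_prod[OF U(1) m(2)] U(3) by blast
      ultimately have "mat_scale c (X (x_prod x S)) = mat_scale c (Y (x_prod x S))"
        using less.prems by (simp add: linear_on_scale[OF lin(1)] linear_on_scale[OF lin(2)])
      moreover have "c \<noteq> 0" using c(1) by auto
      ultimately show ?thesis by simp
    qed
  qed
  show "X h = Y h" if "h \<in> H n x" for h
    by (rule H_eqI[OF lin basis that])
qed

lemma gns_inj: "inj_on gns (Gamma n \<mu> x)"
  using vacuum_separating Gamma_subset_commutant by (auto simp: inj_on_def gns_def)

section \<open>The embedding of the hypercube\<close>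

lemma gamma_in_Gamma: "j \<in> {1..n} \<Longrightarrow> gamma n \<mu> x j \<in> Gamma n \<mu> x"
  unfolding Gamma_def using Hs.vN_generated_incl by blast

lemma gamma_adj_in_Gamma: "j \<in> {1..n} \<Longrightarrow> gamma_adj j \<in> Gamma n \<mu> x"
  using Hs.vN_generated_adj[of "gamma n \<mu> x j" "gamma n \<mu> x ` {1..n}"] gamma_in_Gamma[of j] H_adj_gamma[of j]
  by (simp add: Gamma_def)

lemma eta_eq: "j \<in> {1..n} \<Longrightarrow> h \<in> H n x \<Longrightarrow>
    eta n \<mu> x j h = gamma_adj j (gamma n \<mu> x j h) - mat_scale (complex_of_real (\<mu> j powi (-2))) h"
  by (simp add: eta_def H_adj_gamma)

lemma eta_in_Gamma:
  assumes "j \<in> {1..n}"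
  shows "eta n \<mu> x j \<in> Gamma n \<mu> x"
proof -
  \<comment> \<open>\<open>\<eta>\<^sub>j\<close> as a linear combination of two elements of \<open>\<Gamma>\<close>, indexed by the booleans.\<close>
  let ?Z = "\<lambda>b. if b then compose (H n x) (gamma_adj j) (gamma n \<mu> x j) else (\<lambda>h\<in>H n x. h)"
  let ?c = "\<lambda>b. if b then 1 else - complex_of_real (\<mu> j powi (-2))"
  have "?Z b \<in> Gamma n \<mu> x" for b
    using gamma_in_Gamma[OF assms] gamma_adj_in_Gamma[OF assms]
    unfolding Gamma_def by (simp add: Hs.vN_generated_compose Hs.vN_generated_id)
  then have "(\<lambda>h\<in>H n x. \<Sum>b\<in>UNIV. mat_scale (?c b) (?Z b h)) \<in> Gamma n \<mu> x"
    unfolding Gamma_def by (rule Hs.vN_generated_sum)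
  moreover have "eta n \<mu> x j = (\<lambda>h\<in>H n x. \<Sum>b\<in>UNIV. mat_scale (?c b) (?Z b h))"
    by (rule ext) (auto simp: eta_def H_adj_gamma[OF assms] UNIV_bool compose_eq)
  ultimately show ?thesis by simp
qed

lemma eta_prod_empty: "eta_prod n \<mu> x {} = (\<lambda>h\<in>H n x. h)"
  by (simp add: eta_prod_def)

lemma eta_prod_insert_min:
  assumes "finite A" "\<forall>a\<in>A. b < a"
  shows "eta_prod n \<mu> x (insert b A) = compose (H n x) (eta n \<mu> x b) (eta_prod n \<mu> x A)"
proof -
  have "b \<notin> A" using assms(2) by blast
  moreover have "Min (insert b A) = b"
    using assms by (intro Min_eqI) (auto intro: less_imp_le)
  ultimately show ?thesis
    using assms(1) by (simp add: eta_prod_def sorted_list_of_set_nonempty)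
qed

lemma eta_prod_in_Gamma:
  assumes "A \<subseteq> {1..n}"
  shows "eta_prod n \<mu> x A \<in> Gamma n \<mu> x"
  using finite_subset[OF assms finite_atLeastAtMost] assms
proof (induction A rule: finite_linorder_min_induct)
  case empty
  show ?case unfolding eta_prod_empty Gamma_def by (rule Hs.vN_generated_id)
next
  case (insert b A)
  then show ?case
    using eta_in_Gamma[of b] by (simp add: eta_prod_insert_min Gamma_def Hs.vN_generated_compose)
qed

lemma Gamma_lin: "X \<in> Gamma n \<mu> x \<Longrightarrow> X \<in> lin_ops mat_scale (H n x)"
  using Gamma_subset_commutant by (auto simp: Hs.commutant_iff)

text \<open>
  The vacuum vector of \<open>\<eta>\<^sub>A\<close>. By \<open>pair_vec_remove\<close> below, it is the product of the pairs \<open>x\<^bsub>-a\<^esub> x\<^sub>a\<close>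
  over \<open>a \<in> A\<close>.
\<close>

definition pair_vec :: "nat set \<Rightarrow> complex^'m^'m" where
  "pair_vec A = eta_prod n \<mu> x A (mat 1)"

lemma pair_vec_in_H [simp]: "A \<subseteq> {1..n} \<Longrightarrow> pair_vec A \<in> H n x"
  unfolding pair_vec_def by (rule lin_ops_in[OF Gamma_lin[OF eta_prod_in_Gamma] one_in_H])

text \<open>
  Where neither \<open>j\<close> nor \<open>-j\<close> is occupied, all annihilations vanish. In \<open>\<gamma>\<^sub>j\<^sup>* \<gamma>\<^sub>j h\<close>, creating
  \<open>j\<close> and annihilating it again returns \<open>\<mu>\<^sub>j\<^sup>-\<^sup>2 h\<close>, exactly the constant subtracted in \<open>\<eta>\<^sub>j\<close>; only the
  created pair survives.
\<close>

lemma gamma_unoccupied: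
  assumes "j \<in> {1..n}" "h \<in> H n x" "P (int j) h = 0" "P (- int j) h = 0"
  shows "gamma n \<mu> x j h = mat_scale (complex_of_real (inverse (\<mu> j))) (x (int j) ** h)"
    and "gamma_adj j h = mat_scale (complex_of_real (\<mu> j)) (x (- int j) ** h)"
    and "eta n \<mu> x j h = x (- int j) ** (x (int j) ** h)"
proof -
  have pm: "int j \<in> pm n" "- int j \<in> pm n" "- int j \<noteq> int j" using assms(1) pm_neq_minus by simp_all
  show 1: "gamma n \<mu> x j h = mat_scale (complex_of_real (inverse (\<mu> j))) (x (int j) ** h)"
    "gamma_adj j h = mat_scale (complex_of_real (\<mu> j)) (x (- int j) ** h)"
    using assms pm by (simp_all add: gamma_comb gamma_adj_def lin_comb_def ladder_eq)
  have "\<mu> j powi (-2) = inverse (\<mu> j) * inverse (\<mu> j)" "complex_of_real (\<mu> j) * inverse (complex_of_real (\<mu> j)) = 1"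
    using \<mu>_pos[OF assms(1)] by (auto simp: power_int_minus power2_eq_square)
  then show "eta n \<mu> x j h = x (- int j) ** (x (int j) ** h)"
    using assms pm
    by (simp add: eta_eq 1 gamma_adj_def lin_comb_def ladder_eq P_left_same P_left_other
        mat.scale_right_distrib)
qed

text \<open>
  The two claims need each other: the action of \<open>\<eta>\<^sub>b\<close> can be computed once \<open>\<plusminus>b\<close> are known to be
  unoccupied, and the resulting formula shows which indices are occupied next.
\<close>

lemma pair_vec_P_insert_min:
  assumes "A \<subseteq> {1..n}"
  shows "(\<forall>i\<in>pm n. P i (pair_vec A) = (if nat \<bar>i\<bar> \<in> A then pair_vec A else 0)) \<and>
    (\<forall>b\<in>{1..n}. (\<forall>a\<in>A. b < a) \<longrightarrow> pair_vec (insert b A) = x (- int b) ** (x (int b) ** pair_vec A))"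
  using finite_subset[OF assms finite_atLeastAtMost] assms
proof (induction A rule: finite_linorder_min_induct)
  have step: "pair_vec (insert b A) = x (- int b) ** (x (int b) ** pair_vec A)"
    if "A \<subseteq> {1..n}" "b \<in> {1..n}" "\<forall>a\<in>A. b < a" "\<forall>i\<in>pm n. P i (pair_vec A) = (if nat \<bar>i\<bar> \<in> A then pair_vec A else 0)" for A b
  proof -
    have "b \<notin> A" "finite A" using that(1,3) finite_subset by auto
    then have "P (int b) (pair_vec A) = 0" "P (- int b) (pair_vec A) = 0"
      using that(4) pm_int[OF that(2)] pm_minus[OF pm_int[OF that(2)]] by (auto simp del: pm_int pm_minus)
    then show ?thesis
      using gamma_unoccupied(3)[OF that(2) pair_vec_in_H[OF that(1)]] eta_prod_insert_min[OF \<open>finite A\<close> that(3)]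
      by (simp add: pair_vec_def compose_eq)
  qed
  {
    case empty
    have "\<forall>i\<in>pm n. P i (pair_vec {}) = (if nat \<bar>i\<bar> \<in> {} then pair_vec {} else 0)"
      by (simp add: pair_vec_def eta_prod_empty)
    then show ?case using step[of "{}"] by simp
  next
    case (insert b A)
    then have A: "A \<subseteq> {1..n}" "b \<in> {1..n}" "b \<notin> A" "insert b A \<subseteq> {1..n}" by auto
    have IH: "P i (pair_vec A) = (if nat \<bar>i\<bar> \<in> A then pair_vec A else 0)" if "i \<in> pm n" for i
      using insert.IH A(1) that by simp
    have pair_vec: "pair_vec (insert b A) = x (- int b) ** (x (int b) ** pair_vec A)"
      using insert A by simp
    have pm: "int b \<in> pm n" "- int b \<in> pm n" "- int b \<noteq> int b" using A(2) pm_neq_minus by simp_all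
    have "P i (pair_vec (insert b A)) = (if nat \<bar>i\<bar> \<in> insert b A then pair_vec (insert b A) else 0)" if i: "i \<in> pm n" for i
    proof -
      consider "i = int b" | "i = - int b" | "nat \<bar>i\<bar> \<noteq> b" by linarith
      then show ?thesis
      proof cases
        case 1
        then show ?thesis using A pm IH[OF i] unfolding pair_vec
          by (simp add: P_left_same P_left_other)
      next
        case 2
        then show ?thesis using A pm IH[OF i] unfolding pair_vec
          by (simp add: P_left_same P_left_other)
      next
        case 3
        then have "i \<noteq> int b" "i \<noteq> - int b" by auto
        then show ?thesis using A pm IH[OF i] 3 unfolding pair_vec
          by (simp add: P_left_other)
      qed
    qed
    then show ?case using step[OF A(4)] by blast
  }
qed

lemma P_pair_vec: "A \<subseteq> {1..n} \<Longrightarrow> i \<in> pm n \<Longrightarrow> P i (pair_vec A) = (if nat \<bar>i\<bar> \<in> A then pair_vec A else 0)"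
  and pair_vec_insert_min: "A \<subseteq> {1..n} \<Longrightarrow> b \<in> {1..n} \<Longrightarrow> \<forall>a\<in>A. b < a \<Longrightarrow>
    pair_vec (insert b A) = x (- int b) ** (x (int b) ** pair_vec A)"
  using pair_vec_P_insert_min by blast+

text \<open>
  Both \<open>x\<^sub>b\<close> and \<open>x\<^bsub>-b\<^esub>\<close> pass \<open>x\<^sub>c\<close> at the cost of the same sign \<open>\<epsilon>(b,c)\<close>, so the two signs
  cancel.
\<close>

lemma pair_commute:
  fixes h :: "complex^'m^'m"
  assumes "b \<in> {1..n}" "c \<in> pm n" "\<bar>c\<bar> \<noteq> int b"
  shows "x (- int b) ** (x (int b) ** (x c ** h)) = x c ** (x (- int b) ** (x (int b) ** h))"
proof -
  have pm: "int b \<in> pm n" "- int b \<in> pm n" using assms(1) by simp_all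
  have ne: "int b \<noteq> c" "- int b \<noteq> c" using assms(3) by auto
  define e where "e = complex_of_int (\<epsilon> (int b) c)"
  have e: "\<epsilon> (- int b) c = \<epsilon> (int b) c" "e * e = 1"
  proof -
    show "\<epsilon> (- int b) c = \<epsilon> (int b) c" by (rule eps_minus[OF pm(1) assms(2)])
    have "\<epsilon> (int b) c = 1 \<or> \<epsilon> (int b) c = - 1" using eps[OF pm(1) assms(2)] by blast
    then show "e * e = 1" by (auto simp: e_def)
  qed
  have "x (int b) ** (x c ** h) = mat_scale e (x c ** (x (int b) ** h))"
    using x_comm_mult[OF pm(1) assms(2) ne(1)] by (simp add: e_def)
  moreover have "x (- int b) ** (x c ** g) = mat_scale e (x c ** (x (- int b) ** g))" for g :: "complex^'m^'m"
    using x_comm_mult[OF pm(2) assms(2) ne(2)] e(1) by (simp add: e_def)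
  ultimately show ?thesis by (simp add: e(2))
qed

text \<open>
  Since the pairs commute, any pair, not only the one with the least index, can be moved to the
  front.
\<close>

lemma pair_vec_remove:
  assumes "A \<subseteq> {1..n}" "j \<in> A"
  shows "pair_vec A = x (- int j) ** (x (int j) ** pair_vec (A - {j}))"
  using finite_subset[OF assms(1) finite_atLeastAtMost] assms
proof (induction A rule: finite_linorder_min_induct)
  case empty
  then show ?case by simp
next
  case (insert b A)
  then have A: "A \<subseteq> {1..n}" "b \<in> {1..n}" "b \<notin> A" by auto
  show ?case
  proof (cases "j = b")
    case True
    then have "insert b A - {j} = A" using A by auto
    then show ?thesis using True pair_vec_insert_min[OF A(1,2)] insert.hyps by simp
  next
    case False
    then have j: "j \<in> A" "j \<in> {1..n}" using insert.prems A by auto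
    have ins: "insert b A - {j} = insert b (A - {j})" using False by auto
    have "pair_vec (insert b A) = x (- int b) ** (x (int b) ** (x (- int j) ** (x (int j) ** pair_vec (A - {j}))))"
      using pair_vec_insert_min[OF A(1,2)] insert.hyps insert.IH[OF A(1) j(1)] by simp
    also have "\<dots> = x (- int j) ** (x (int j) ** (x (- int b) ** (x (int b) ** pair_vec (A - {j}))))"
      using False j pair_commute[OF A(2), of "- int j" "x (int j) ** pair_vec (A - {j})"]
        pair_commute[OF A(2), of "int j" "pair_vec (A - {j})"] by simp
    also have "x (- int b) ** (x (int b) ** pair_vec (A - {j})) = pair_vec (insert b A - {j})"
      unfolding ins using A insert.hyps by (intro pair_vec_insert_min[symmetric]) auto
    finally show ?thesis .
  qed
qed

text \<open>
  Annihilating one index of the pair at \<open>j\<close> leaves the other one, with a sign from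
  \<open>x\<^sub>j x\<^bsub>-j\<^esub> = - x\<^bsub>-j\<^esub> x\<^sub>j\<close> if \<open>j\<close> is the one removed; the surviving single index is also what \<open>\<gamma>\<^sub>j\<^sup>*\<close>
  or \<open>\<gamma>\<^sub>j\<close> creates from the vector without the pair.
\<close>

lemma beta_pair_vec:
  assumes "A \<subseteq> {1..n}" "j \<in> {1..n}"
  shows "beta n x (int j) (pair_vec A) =
      (if j \<in> A then mat_scale (- complex_of_real (inverse (\<mu> j))) (gamma_adj j (pair_vec (A - {j}))) else 0)"
    and "beta n x (- int j) (pair_vec A) =
      (if j \<in> A then mat_scale (complex_of_real (\<mu> j)) (gamma n \<mu> x j (pair_vec (A - {j}))) else 0)"
proof -
  have pm: "int j \<in> pm n" "- int j \<in> pm n" "int j \<noteq> - int j" using assms(2) pm_neq_minus by simp_all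
  have B: "A - {j} \<subseteq> {1..n}" using assms(1) by auto
  have mu: "complex_of_real (\<mu> j) \<noteq> 0" using \<mu>_pos[OF assms(2)] by simp
  have vac: "P (int j) (pair_vec (A - {j})) = 0" "P (- int j) (pair_vec (A - {j})) = 0"
    using P_pair_vec[OF B pm(1)] P_pair_vec[OF B pm(2)] by simp_all
  note g = gamma_unoccupied(1,2)[OF assms(2) pair_vec_in_H[OF B] vac]
  have occ: "P i (pair_vec A) = (if j \<in> A then pair_vec A else 0)" if "i = int j \<or> i = - int j" for i
    using P_pair_vec[OF assms(1), of i] pm that by auto
  have anti: "x (int j) ** pair_vec A = - (x (- int j) ** pair_vec (A - {j}))" if "j \<in> A"
    using x_comm_mult[OF pm, of "x (int j) ** pair_vec (A - {j})"] eps_minus_self[OF pm(1)] pm pair_vec_remove[OF assms(1) that] by simp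
  have minus: "x (- int j) ** pair_vec A = x (int j) ** pair_vec (A - {j})" if "j \<in> A"
    using pm pair_vec_remove[OF assms(1) that] by simp
  show "beta n x (int j) (pair_vec A) =
      (if j \<in> A then mat_scale (- complex_of_real (inverse (\<mu> j))) (gamma_adj j (pair_vec (A - {j}))) else 0)"
    using mu by (simp add: beta_eq[OF pair_vec_in_H[OF assms(1)]] occ g anti)
  show "beta n x (- int j) (pair_vec A) =
      (if j \<in> A then mat_scale (complex_of_real (\<mu> j)) (gamma n \<mu> x j (pair_vec (A - {j}))) else 0)"
    using mu by (simp add: beta_eq[OF pair_vec_in_H[OF assms(1)]] occ g minus)
qed

end

context fock_cube
begin

section \<open>The number operator and the Riesz transforms\<close>

text \<open>
  The product \<open>\<beta>\<^sub>i\<^sup>* \<beta>\<^sub>i\<close> is the projection \<open>P\<^sub>i\<close>, so \<open>N\<^sup>\<epsilon>\<close> counts occupied indices.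
\<close>

lemma N_eps_eq: "h \<in> H n x \<Longrightarrow> N_eps n x h = (\<Sum>i\<in>pm n. P i h)"
  unfolding N_eps_def by (auto intro!: sum.cong simp: ladder_eq P_left_same mat_mult_diff)

lemma N_eps_x_prod:
  assumes "S \<subseteq> pm n"
  shows "N_eps n x (x_prod x S) = mat_scale (complex_of_real (card S)) (x_prod x S)"
proof -
  have "N_eps n x (x_prod x S) = (\<Sum>i\<in>pm n. if i \<in> S then x_prod x S else 0)"
    using assms by (simp add: N_eps_eq P_x_prod)
  also have "\<dots> = (\<Sum>i\<in>S. x_prod x S)"
    using assms by (simp add: sum.inter_restrict[symmetric] Int_absorb1)
  finally show ?thesis
    by (simp add: mat.sum_constant_scale del: sum_constant)
qed

lemma N_eps_pair_vec:
  assumes "A \<subseteq> {1..n}"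
  shows "N_eps n x (pair_vec A) = mat_scale (complex_of_real (2 * card A)) (pair_vec A)"
proof -
  have "N_eps n x (pair_vec A) = (\<Sum>i\<in>pm n. if nat \<bar>i\<bar> \<in> A then pair_vec A else 0)"
    using assms by (simp add: N_eps_eq P_pair_vec)
  also have "\<dots> = (\<Sum>j\<in>{1..n}. if j \<in> A then pair_vec A + pair_vec A else 0)"
    unfolding sum_pm by (intro sum.cong) auto
  also have "\<dots> = (\<Sum>j\<in>A. mat_scale 2 (pair_vec A))"
    using assms mat.scale_left_distrib[of 1 1 "pair_vec A"] by (simp add: sum.inter_restrict[symmetric] Int_absorb1)
  finally show ?thesis
    by (simp add: mat.sum_constant_scale mult.commute del: sum_constant)
qed

lemma N_eps_linear: "linear_on mat_scale mat_scale (H n x) (N_eps n x)"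
  by (simp add: linear_on_def N_eps_eq sum.distrib mat.scale_sum_right)

sublocale H0s: onb_space mat_scale "H0 n x" "H_ip n x" "Pow (pm n) - {{}}" "x_prod x"
  using Hs.onb_space_complement[of "{}"] by (simp add: H0_def)

lemma pair_vec_in_H0:
  assumes "A \<subseteq> {1..n}" "A \<noteq> {}"
  shows "pair_vec A \<in> H0 n x"
proof -
  obtain a where a: "a \<in> A" "a \<in> {1..n}" using assms by blast
  have "H_ip n x (mat 1) (pair_vec A) = H_ip n x (mat 1) (P (int a) (pair_vec A))"
    using P_pair_vec[OF assms(1) pm_int[OF a(2)]] a(1) by simp
  also have "\<dots> = H_ip n x (P (int a) (mat 1)) (pair_vec A)"
    by (rule ip_P[OF one_in_H pair_vec_in_H[OF assms(1)], symmetric])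
  also have "\<dots> = 0"
    using Hs.ip_scale_left[of "pair_vec A" 0 0] assms(1) by simp
  finally show ?thesis
    using assms(1) by (simp add: H0_def)
qed

lemma N_eps_inv_sqrt:
  shows "inv_sqrt mat_scale (H0 n x) (H_ip n x) (N_eps n x) \<in> lin_ops mat_scale (H0 n x)"
    and "A \<in> Pow {1..n} - {{}} \<Longrightarrow> inv_sqrt mat_scale (H0 n x) (H_ip n x) (N_eps n x) (pair_vec A) =
           mat_scale (complex_of_real (1 / sqrt (2 * card A))) (pair_vec A)"
proof -
  have lin: "linear_on mat_scale mat_scale (H0 n x) (N_eps n x)"
    by (rule linear_on_subset[OF N_eps_linear]) (auto simp: H0_def)
  have diag: "N_eps n x (x_prod x S) = mat_scale (complex_of_real (real (card S))) (x_prod x S)"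
    "0 < real (card S)" if "S \<in> Pow (pm n) - {{}}" for S
    using that N_eps_x_prod[of S] finite_subset_pm[of S] by (auto simp: card_gt_0_iff)
  show "inv_sqrt mat_scale (H0 n x) (H_ip n x) (N_eps n x) \<in> lin_ops mat_scale (H0 n x)"
    by (rule H0s.inv_sqrt_props(1)[OF lin diag])
  show "inv_sqrt mat_scale (H0 n x) (H_ip n x) (N_eps n x) (pair_vec A) =
           mat_scale (complex_of_real (1 / sqrt (2 * card A))) (pair_vec A)" if A: "A \<in> Pow {1..n} - {{}}"
  proof (rule H0s.inv_sqrt_props(2)[OF lin diag])
    show "pair_vec A \<in> H0 n x" using A pair_vec_in_H0 by auto
    show "N_eps n x (pair_vec A) = mat_scale (complex_of_real (2 * card A)) (pair_vec A)" using A N_eps_pair_vec by auto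
    show "0 < real (2 * card A)" using A finite_subset[of A "{1..n}"] by (auto simp: card_gt_0_iff)
  qed
qed

lemma Phi_linear: "h \<in> H n x \<Longrightarrow> linear_on fn_scale mat_scale (L_Omega n) (\<lambda>f. Phi n \<mu> x f h)"
  unfolding Phi_def
  using linear_on_lin_ext[OF fn.vector_space_axioms mat.vector_space_axioms L.independent_basis eq_refl[OF L.V_eq]]
  by simp

lemma Phi_zeta: "A \<subseteq> {1..n} \<Longrightarrow> h \<in> H n x \<Longrightarrow> Phi n \<mu> x (zeta n \<mu> A) h = eta_prod n \<mu> x A h"
  by (simp add: Phi_def L_lin_ext_zeta mat.vector_space_axioms)

lemma Phi_expand:
  "f \<in> L_Omega n \<Longrightarrow> Phi n \<mu> x f =
    (\<lambda>h\<in>H n x. \<Sum>A\<in>Pow {1..n}. mat_scale (L_ip n \<mu> (zeta n \<mu> A) f) (eta_prod n \<mu> x A h))"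
  by (rule ext) (simp add: Phi_def L.lin_ext_eq[OF mat.vector_space_axioms])

lemma Phi_in_Gamma:
  assumes "f \<in> L_Omega n"
  shows "Phi n \<mu> x f \<in> Gamma n \<mu> x"
  unfolding Phi_expand[OF assms] Gamma_def
  by (rule Hs.vN_generated_sum) (use eta_prod_in_Gamma in \<open>auto simp: Gamma_def\<close>)

lemma gns_Phi:
  assumes "f \<in> L_Omega0 n \<mu>"
  shows "gns (Phi n \<mu> x f) = (\<Sum>A\<in>Pow {1..n} - {{}}. mat_scale (L_ip n \<mu> (zeta n \<mu> A) f) (pair_vec A))"
proof -
  have f: "f \<in> L_Omega n" "L_ip n \<mu> (zeta n \<mu> {}) f = 0"
    using assms by (auto simp: L_Omega0_eq)
  have "gns (Phi n \<mu> x f) = (\<Sum>A\<in>Pow {1..n}. mat_scale (L_ip n \<mu> (zeta n \<mu> A) f) (pair_vec A))"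
    by (simp add: gns_def Phi_expand[OF f(1)] pair_vec_def)
  then show ?thesis
    using f(2) sum.remove[of "Pow {1..n}" "{}" "\<lambda>A. mat_scale (L_ip n \<mu> (zeta n \<mu> A) f) (pair_vec A)"] by simp
qed

lemma op_scale_in_Gamma: "X \<in> Gamma n \<mu> x \<Longrightarrow> op_scale n x c X \<in> Gamma n \<mu> x"
  using Hs.vN_generated_sum[of "{()}" "\<lambda>_. X" _ "\<lambda>_. c"] by (simp add: Gamma_def op_scale_def)

lemma R_op_in: "f \<in> L_Omega0 n \<mu> \<Longrightarrow> R_op n \<mu> j f \<in> L_Omega n"
  unfolding R_op_expand by (intro L.V_sum L.V_scale) (auto simp: zeta_in)

text \<open>
  Both identities of the theorem at once: \<open>i\<close> is \<open>j\<close> or \<open>-j\<close>, and \<open>G\<close> is \<open>\<gamma>\<^sub>j\<^sup>*\<close> or \<open>\<gamma>\<^sub>j\<close>. As the right-hand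
  side lies in \<open>\<Gamma>\<close> and \<open>\<Gamma>\<close> is embedded by its vacuum vectors, it is enough to compare vacuum vectors,
  for which \<open>\<beta>\<^sub>i\<close> is given by the assumption on \<open>G\<close>.
\<close>

lemma R_eps_Phi:
  assumes f: "f \<in> L_Omega0 n \<mu>" and j: "j \<in> {1..n}" and i: "i \<in> pm n" and G: "G \<in> Gamma n \<mu> x"
    and beta: "\<And>A. A \<subseteq> {1..n} \<Longrightarrow> beta n x i (pair_vec A) =
      (if j \<in> A then mat_scale (complex_of_real d) (G (pair_vec (A - {j}))) else 0)"
  shows "R_eps n \<mu> x i (Phi n \<mu> x f) =
    op_scale n x (complex_of_real (sqrt 2 * d / (\<mu> j powi 2 + \<mu> j powi (-2))))
      (compose (H n x) G (Phi n \<mu> x (R_op n \<mu> j f)))"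
proof -
  let ?P = "Pow {1..n} - {{}}"
  let ?c = "\<lambda>A. L_ip n \<mu> (zeta n \<mu> A) f"
  let ?Q = "inv_sqrt mat_scale (H0 n x) (H_ip n x) (N_eps n x)"
  let ?s = "\<mu> j powi (-2) + \<mu> j powi 2"
  let ?k = "sqrt 2 * d / (\<mu> j powi 2 + \<mu> j powi (-2))"
  let ?Y = "op_scale n x (complex_of_real ?k) (compose (H n x) G (Phi n \<mu> x (R_op n \<mu> j f)))"
  \<comment> \<open>\<open>t / 2\<close> is the normalisation of \<open>R\<^sub>j\<close>; the left factor is the constant of the claim.\<close>
  have norm_const: "sqrt 2 * d / t * (t / 2 / r) = 1 / (sqrt 2 * r) * d" if "t > 0" for t r :: real
  proof -
    have "sqrt 2 * d / t * (t / 2 / r) = sqrt 2 / 2 * (d / r)" using that by simp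
    also have "sqrt 2 / 2 = 1 / sqrt (2::real)" by (simp add: divide_simps)
    finally show ?thesis by simp
  qed
  have s: "?s > 0" using \<mu>_pos[OF j] by (intro add_pos_pos) auto
  have fL: "f \<in> L_Omega n" using f by (simp add: L_Omega0_eq)
  have vec: "vector_space mat_scale" by (rule mat.vector_space_axioms)
  have gns_f: "gns (Phi n \<mu> x f) \<in> H0 n x"
    unfolding gns_Phi[OF f] by (intro H0s.V_sum H0s.V_scale pair_vec_in_H0) auto
  have "Phi n \<mu> x f \<in> Gamma0 n \<mu> x"
    using Phi_in_Gamma[OF fL] gns_f by (simp add: Gamma0_def tau_def H0_def gns_def)
  then have R: "R_eps n \<mu> x i (Phi n \<mu> x f) =
      the_inv_into (Gamma n \<mu> x) gns (beta n x i (?Q (gns (Phi n \<mu> x f))))"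
    by (simp add: R_eps_def)
  have Y: "?Y \<in> Gamma n \<mu> x"
    unfolding Gamma_def
    using G Phi_in_Gamma[OF R_op_in[OF f]]
    by (intro op_scale_in_Gamma[unfolded Gamma_def] Hs.vN_generated_compose) (auto simp: Gamma_def)
  have "?Q (gns (Phi n \<mu> x f)) = (\<Sum>A\<in>?P. mat_scale (?c A) (?Q (pair_vec A)))"
    unfolding gns_Phi[OF f]
    by (rule linear_on_sum[OF vec vec H0s.subspace_V lin_ops_linear[OF N_eps_inv_sqrt(1)]])
       (use pair_vec_in_H0 in auto)
  also have "\<dots> = (\<Sum>A\<in>?P. mat_scale (?c A * complex_of_real (1 / sqrt (2 * card A))) (pair_vec A))"
    by (intro sum.cong refl) (simp add: N_eps_inv_sqrt(2))
  finally have "beta n x i (?Q (gns (Phi n \<mu> x f))) =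
      (\<Sum>A\<in>?P. mat_scale (?c A * complex_of_real (1 / sqrt (2 * card A))) (beta n x i (pair_vec A)))"
    using linear_on_sum[OF vec vec Hs.subspace_V lin_ops_linear[OF ladder_lin_ops(1)[OF i]], of ?P pair_vec
        "\<lambda>A. ?c A * complex_of_real (1 / sqrt (2 * card A))"] by simp
  also have "\<dots> = gns ?Y"
  proof -
    have G': "G \<in> lin_ops mat_scale (H n x)" by (rule Gamma_lin[OF G])
    have "Phi n \<mu> x (R_op n \<mu> j f) (mat 1) = (\<Sum>A\<in>?P. mat_scale (complex_of_real (?s / 2 / sqrt (card A)) * ?c A)
        (Phi n \<mu> x (if j \<in> A then zeta n \<mu> (A - {j}) else 0) (mat 1)))"
      unfolding R_op_expand[OF f]
      by (rule linear_on_sum[OF fn.vector_space_axioms vec L.subspace_V Phi_linear[OF one_in_H]])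
         (auto simp: zeta_in)
    also have "\<dots> = (\<Sum>A\<in>?P. mat_scale (complex_of_real (?s / 2 / sqrt (card A)) * ?c A)
        (if j \<in> A then pair_vec (A - {j}) else 0))"
    proof (intro sum.cong refl arg_cong2[where f = mat_scale])
      fix A assume "A \<in> ?P"
      then have "A - {j} \<subseteq> {1..n}" by auto
      then show "Phi n \<mu> x (if j \<in> A then zeta n \<mu> (A - {j}) else 0) (mat 1) = (if j \<in> A then pair_vec (A - {j}) else 0)"
        using linear_on_scale[OF Phi_linear[OF one_in_H], of 0 0] by (simp add: Phi_zeta pair_vec_def)
    qed
    finally have "gns ?Y = mat_scale (complex_of_real ?k)
        (G (\<Sum>A\<in>?P. mat_scale (complex_of_real (?s / 2 / sqrt (card A)) * ?c A) (if j \<in> A then pair_vec (A - {j}) else 0)))"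
      by (simp add: gns_def op_scale_def compose_eq)
    also have "\<dots> = mat_scale (complex_of_real ?k)
        (\<Sum>A\<in>?P. mat_scale (complex_of_real (?s / 2 / sqrt (card A)) * ?c A) (G (if j \<in> A then pair_vec (A - {j}) else 0)))"
      by (subst linear_on_sum[OF vec vec Hs.subspace_V lin_ops_linear[OF G']]) (auto intro!: pair_vec_in_H)
    also have "\<dots> = (\<Sum>A\<in>?P. mat_scale (?c A * complex_of_real (1 / sqrt (2 * card A))) (beta n x i (pair_vec A)))"
      unfolding mat.scale_sum_right
    proof (intro sum.cong refl)
      fix A assume "A \<in> ?P"
      then have A: "A \<subseteq> {1..n}" by auto
      have coeff: "?k * (?s / 2 / sqrt (card A)) = 1 / sqrt (2 * card A) * d"
        using norm_const[of ?s "sqrt (card A)"] s by (simp add: real_sqrt_mult add.commute)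
      have k: "complex_of_real ?k * (complex_of_real (?s / 2 / sqrt (card A)) * ?c A) =
          ?c A * complex_of_real (1 / sqrt (2 * card A)) * complex_of_real d"
        using arg_cong[OF coeff, of "\<lambda>t. complex_of_real t * ?c A"] by (simp only: of_real_mult mult_ac)
      have G0: "G 0 = 0"
        using linear_on_scale[OF lin_ops_linear[OF G'], of 0 0] by simp
      then show "mat_scale (complex_of_real ?k) (mat_scale (complex_of_real (?s / 2 / sqrt (card A)) * ?c A)
            (G (if j \<in> A then pair_vec (A - {j}) else 0))) =
          mat_scale (?c A * complex_of_real (1 / sqrt (2 * card A))) (beta n x i (pair_vec A))"
        by (cases "j \<in> A") (simp_all only: beta[OF A] if_True if_False mat.scale_scale mat.scale_zero_right k G0)
    qed
    finally show ?thesis by simp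
  qed
  finally show ?thesis
    unfolding R using the_inv_into_f_f[OF gns_inj Y] by simp
qed

end

theorem proposition3p9:
  fixes n :: nat and \<mu> :: "nat \<Rightarrow> real" and \<epsilon> :: "int \<Rightarrow> int \<Rightarrow> int"
    and x :: "int \<Rightarrow> complex^'m^'m" and f :: "(nat \<Rightarrow> int) \<Rightarrow> complex" and j :: nat
  assumes "n \<ge> 1"
    and "\<And>i. i \<in> {1..n} \<Longrightarrow> \<mu> i > 0"
    and "\<And>i k. i \<in> pm n \<Longrightarrow> k \<in> pm n \<Longrightarrow>
           \<epsilon> i k \<in> {-1, 1} \<and> \<epsilon> i k = \<epsilon> k i \<and> \<epsilon> i k = \<epsilon> \<bar>i\<bar> \<bar>k\<bar>"
    and "\<And>i. i \<in> pm n \<Longrightarrow> \<epsilon> i i = -1"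
    and "CARD('m) = 2 ^ (2 * n)"
    and "\<And>i. i \<in> pm n \<Longrightarrow> mat_adj (x i) = x i"
    and "\<And>i k. i \<in> pm n \<Longrightarrow> k \<in> pm n \<Longrightarrow>
           x i ** x k - mat_scale (of_int (\<epsilon> i k)) (x k ** x i) = mat_scale (if i = k then 2 else 0) (mat 1)"
    and "inj_on (x_prod x) (Pow (pm n))"
    and "mat.independent (x_prod x ` Pow (pm n))"
    and "f \<in> L_Omega n"
    and "(LINT \<omega>|nu n \<mu>. f \<omega>) = 0"
    and "j \<in> {1..n}"
  shows "R_eps n \<mu> x (int j) (Phi n \<mu> x f) =
           op_scale n x (complex_of_real (- (sqrt 2 * inverse (\<mu> j) / (\<mu> j powi 2 + \<mu> j powi (-2)))))
             (compose (H n x) (H_adj n x (gamma n \<mu> x j)) (Phi n \<mu> x (R_op n \<mu> j f)))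
       \<and> R_eps n \<mu> x (- int j) (Phi n \<mu> x f) =
           op_scale n x (complex_of_real (sqrt 2 * \<mu> j / (\<mu> j powi 2 + \<mu> j powi (-2))))
             (compose (H n x) (gamma n \<mu> x j) (Phi n \<mu> x (R_op n \<mu> j f)))"
proof -
  interpret fock_cube n \<mu> \<epsilon> x
    by unfold_locales (use assms in blast)+
  have f: "f \<in> L_Omega0 n \<mu>" using assms(10,11) by (simp add: L_Omega0_def)
  note j = \<open>j \<in> {1..n}\<close>
  show ?thesis
  proof
    show "R_eps n \<mu> x (int j) (Phi n \<mu> x f) =
           op_scale n x (complex_of_real (- (sqrt 2 * inverse (\<mu> j) / (\<mu> j powi 2 + \<mu> j powi (-2)))))
             (compose (H n x) (H_adj n x (gamma n \<mu> x j)) (Phi n \<mu> x (R_op n \<mu> j f)))"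
      using R_eps_Phi[OF f j pm_int[OF j] gamma_adj_in_Gamma[OF j], of "- inverse (\<mu> j)"] beta_pair_vec(1)[OF _ j]
      by (simp add: H_adj_gamma[OF j])
    show "R_eps n \<mu> x (- int j) (Phi n \<mu> x f) =
           op_scale n x (complex_of_real (sqrt 2 * \<mu> j / (\<mu> j powi 2 + \<mu> j powi (-2))))
             (compose (H n x) (gamma n \<mu> x j) (Phi n \<mu> x (R_op n \<mu> j f)))"
      by (rule R_eps_Phi[OF f j pm_minus[OF pm_int[OF j]] gamma_in_Gamma[OF j] beta_pair_vec(2)[OF _ j]])
  qed
qed

end
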